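(* There exist positive real numbers $t_1,\ldots,t_N$ such that for any $\alpha^{(a)}\in\mathcal{C}_q$, the intersection $$ Z_{\alpha^{(a)}}\cap\mathcal{H}(1,t_1)\cap\cdots\cap\mathcal{H}(1,t_{|\alpha^{(a)}|}) $$ is transverse with all points of intersection real.
   Context: Fix integers $m,p>1$ and $q\geq 0$, set $n:=m+p$ and $N:=pm+qn$. Let $\mathbf{G}$ be the Grassmannian of $p$-planes in $\mathbb{C}^n$, and $\mathcal{M}_q$ the space of maps $\mathbb{P}^1\to\mathbf{G}$ of degree $q$. A map is represented by a $p\times n$ matrix $M$ of forms in $s,t$ whose maximal minors have degree $q$; for $\alpha\in\binom{[n]}{p}$ and $0\le a\le q$, the Plücker coordinate $z_{\alpha^{(a)}}$ is the coefficient of $s^at^{q-a}$ in the $\alpha$-th maximal minor of $M$. Let $\mathcal{C}_q:=\{\alpha^{(a)}\mid \alpha\in\binom{[n]}{p},\,0\le a\le q\}$, and let $\mathcal{K}_q$ (the quantum Grassmannian) be the closure of the image of $\mathcal{M}_q$ under this Plücker map in $\mathbb{P}(\bigwedge^p\mathbb{C}^n\otimes H^0(\mathcal{O}_{\mathbb{P}^1}(q))^* )$. Partially order $\mathcal{C}_q$ by: $\alpha^{(a)}\ge\beta^{(b)}$ iff $a\ge b$ and, if $a-b<p$, then $\alpha_{a-b+1}\ge\beta_1,\ldots,\alpha_p\ge\beta_{p-a+b}$. The rank is $|\alpha^{(a)}|=an+\sum_i(\alpha_i-i)$, and write $|\alpha|:=\sum_i(\alpha_i-i)$. The quantum Schubert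 variety is $Z_{\alpha^{(a)}}:=\{z\in\mathcal{K}_q\mid z_{\beta^{(b)}}=0 \text{ if } \beta^{(b)}\not\le\alpha^{(a)}\}$. Let $\gamma(s,t)=(s^{n-1},ts^{n-2},\ldots,t^{n-1})$ be the rational normal curve and $L(s,t)$ the $m\times n$ matrix with rows $\gamma,\gamma',\ldots,\gamma^{(m-1)}$ (derivatives in $t$); $(-1)^{|\alpha|}l_\alpha$ is the maximal minor of $L(1,1)$ complementary to $\alpha$. $\mathcal{H}(s,t)$ is the hyperplane defined by the linear form $\Lambda(s,t):=\sum_{\alpha^{(a)}\in\mathcal{C}_q} z_{\alpha^{(a)}} l_\alpha s^{|\alpha^{(a)}|}t^{N-|\alpha^{(a)}|}$; on $\mathcal{M}_q$ it cuts out the maps $M$ with $M(s^n,t^n)\cap L(s,t)\neq\{0\}$. *)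

theory Defs
  imports "HOL-Analysis.Analysis"
begin

text \<open>Index conventions: rows/columns and the entries alpha_i of a p-subset
alpha of [n] = {1..n} are 1-based.  A p-subset alpha is a nat set; its i-th
smallest element (i = 1..p) is elt alpha i.\<close>

definition elt :: "nat set \<Rightarrow> nat \<Rightarrow> nat" where
  "elt A i = sorted_list_of_set A ! (i - 1)"

definition subsets_p :: "nat \<Rightarrow> nat \<Rightarrow> nat set set" where
  "subsets_p n p = {A. A \<subseteq> {1..n} \<and> card A = p}"

text \<open>The index set C_q: pairs (alpha, a) standing for alpha^(a).\<close>
definition Cq :: "nat \<Rightarrow> nat \<Rightarrow> nat \<Rightarrow> (nat set \<times> nat) set" where
  "Cq m p q = {(A, a). A \<in> subsets_p (m + p) p \<and> a \<le> q}"

definition absa :: "nat \<Rightarrow> nat set \<Rightarrow> nat" where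
  "absa p A = (\<Sum>i=1..p. elt A i - i)"

definition rank_C :: "nat \<Rightarrow> nat \<Rightarrow> nat set \<times> nat \<Rightarrow> nat" where
  "rank_C m p c = snd c * (m + p) + absa p (fst c)"

definition Nbig :: "nat \<Rightarrow> nat \<Rightarrow> nat \<Rightarrow> nat" where
  "Nbig m p q = p * m + q * (m + p)"

definition leC :: "nat \<Rightarrow> nat set \<times> nat \<Rightarrow> nat set \<times> nat \<Rightarrow> bool" where
  "leC p c d = (snd c \<le> snd d \<and>
     (snd d - snd c < p \<longrightarrow>
       (\<forall>i\<in>{1..p - (snd d - snd c)}. elt (fst c) i \<le> elt (fst d) (snd d - snd c + i))))"

definition minor :: "nat \<Rightarrow> (nat \<Rightarrow> nat \<Rightarrow> complex) \<Rightarrow> nat set \<Rightarrow> complex" where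
  "minor r A cols = (\<Sum>\<sigma> | \<sigma> permutes {1..r}.
       of_int (sign \<sigma>) * (\<Prod>i=1..r. A i (elt cols (\<sigma> i))))"

definition is_form :: "(complex \<Rightarrow> complex \<Rightarrow> complex) \<Rightarrow> bool" where
  "is_form F = (\<exists>d c. \<forall>s t. F s t = (\<Sum>k\<le>d. c k * s ^ k * t ^ (d - k)))"

text \<open>A p x n matrix of forms M (entries M i j s t, i = 1..p, j = 1..n)
representing a map P^1 -> G: for every (s,t) <> (0,0), M(s,t) has rank p,
i.e. some maximal minor is nonzero.\<close>
definition is_map :: "nat \<Rightarrow> nat \<Rightarrow> (nat \<Rightarrow> nat \<Rightarrow> complex \<Rightarrow> complex \<Rightarrow> complex) \<Rightarrow> bool" where
  "is_map n p M = ((\<forall>i j. is_form (M i j)) \<and>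
     (\<forall>s t. (s, t) \<noteq> (0, 0) \<longrightarrow>
        (\<exists>A\<in>subsets_p n p. minor p (\<lambda>i j. M i j s t) A \<noteq> 0)))"

text \<open>Plucker image of M_q (as a subset of the affine cone): z is the vector of
Plucker coordinates of a degree-q map M, i.e. every maximal minor of M is the
form of degree q with coefficients z_{alpha^(a)}.\<close>
definition plucker_image :: "nat \<Rightarrow> nat \<Rightarrow> nat \<Rightarrow> ((nat set \<times> nat) \<Rightarrow> complex) set" where
  "plucker_image m p q = {z. (\<forall>c. c \<notin> Cq m p q \<longrightarrow> z c = 0) \<and>
     (\<exists>M. is_map (m + p) p M \<and>
        (\<forall>A\<in>subsets_p (m + p) p. \<forall>s t.
            minor p (\<lambda>i j. M i j s t) A = (\<Sum>a\<le>q. z (A, a) * s ^ a * t ^ (q - a))))}"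

inductive_set polyfun :: "(('c \<Rightarrow> complex) \<Rightarrow> complex) set" where
  pf_const: "(\<lambda>z. a) \<in> polyfun"
| pf_var: "(\<lambda>z. z c) \<in> polyfun"
| pf_add: "f \<in> polyfun \<Longrightarrow> g \<in> polyfun \<Longrightarrow> (\<lambda>z. f z + g z) \<in> polyfun"
| pf_mult: "f \<in> polyfun \<Longrightarrow> g \<in> polyfun \<Longrightarrow> (\<lambda>z. f z * g z) \<in> polyfun"

definition zariski_closure :: "('c \<Rightarrow> complex) set \<Rightarrow> ('c \<Rightarrow> complex) set" where
  "zariski_closure S = {z. \<forall>f\<in>polyfun. (\<forall>y\<in>S. f y = 0) \<longrightarrow> f z = 0}"

definition tangent_space :: "('c \<Rightarrow> complex) set \<Rightarrow> ('c \<Rightarrow> complex) \<Rightarrow> ('c \<Rightarrow> complex) set" where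
  "tangent_space V x = {v. \<forall>f\<in>polyfun. (\<forall>y\<in>V. f y = 0) \<longrightarrow>
       ((\<lambda>e. f (\<lambda>c. x c + e * v c)) has_field_derivative 0) (at 0)}"

text \<open>Affine cone over the quantum Grassmannian K_q.\<close>
definition Kq :: "nat \<Rightarrow> nat \<Rightarrow> nat \<Rightarrow> ((nat set \<times> nat) \<Rightarrow> complex) set" where
  "Kq m p q = zariski_closure (plucker_image m p q)"

text \<open>Affine cone over the quantum Schubert variety Z_{alpha^(a)}.\<close>
definition Zq :: "nat \<Rightarrow> nat \<Rightarrow> nat \<Rightarrow> nat set \<times> nat \<Rightarrow> ((nat set \<times> nat) \<Rightarrow> complex) set" where
  "Zq m p q d = {z \<in> Kq m p q. \<forall>c\<in>Cq m p q. \<not> leC p c d \<longrightarrow> z c = 0}"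

text \<open>L(s,t): rows gamma, gamma', ..., gamma^(m-1) (t-derivatives) of the
rational normal curve gamma(s,t) = (s^(n-1), t s^(n-2), ..., t^(n-1)).
Row i = 1..m is the (i-1)-th derivative; column j = 1..n.\<close>
definition Lmat :: "nat \<Rightarrow> nat \<Rightarrow> complex \<Rightarrow> complex \<Rightarrow> nat \<Rightarrow> nat \<Rightarrow> complex" where
  "Lmat m n s t i j = (deriv ^^ (i - 1)) (\<lambda>\<tau>. s ^ (n - j) * \<tau> ^ (j - 1)) t"

definition lcoef :: "nat \<Rightarrow> nat \<Rightarrow> nat set \<Rightarrow> complex" where
  "lcoef m p A = (-1) ^ absa p A * minor m (Lmat m (m + p) 1 1) ({1..m + p} - A)"

definition Lambda :: "nat \<Rightarrow> nat \<Rightarrow> nat \<Rightarrow> complex \<Rightarrow> complex \<Rightarrow> ((nat set \<times> nat) \<Rightarrow> complex) \<Rightarrow> complex" where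
  "Lambda m p q s t z = (\<Sum>c\<in>Cq m p q. z c * lcoef m p (fst c)
       * s ^ rank_C m p c * t ^ (Nbig m p q - rank_C m p c))"

definition Hyp :: "nat \<Rightarrow> nat \<Rightarrow> nat \<Rightarrow> complex \<Rightarrow> complex \<Rightarrow> ((nat set \<times> nat) \<Rightarrow> complex) set" where
  "Hyp m p q s t = {z. Lambda m p q s t z = 0}"

text \<open>Transverse intersection of the (cone over the) projective variety V with
the linear subspace W: at every point x of the (projective) intersection,
the Zariski tangent space of V meets W exactly in the line through x.\<close>
definition transverse_at_points :: "('c \<Rightarrow> complex) set \<Rightarrow> ('c \<Rightarrow> complex) set \<Rightarrow> bool" where
  "transverse_at_points V W = (\<forall>x\<in>V \<inter> W. x \<noteq> (\<lambda>c. 0) \<longrightarrow>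
       tangent_space V x \<inter> W = {(\<lambda>c. u * x c) | u. True})"

text \<open>A projective point (represented by a nonzero vector) is real.\<close>
definition real_point :: "('c \<Rightarrow> complex) \<Rightarrow> bool" where
  "real_point x = (\<exists>u y. \<forall>c. x c = u * complex_of_real (y c))"

end

theory Submission
  imports Defs "Jordan_Normal_Form.Determinant"
begin

text \<open>
  The quantum Grassmannian is replaced by the larger locus \<open>V\<close> of all real quadrics vanishing on it, and
  tangent spaces by the kernels of the linearised quadrics: enlarging both only makes transversality
  and reality harder. The coefficients of the Pluecker exchange relation
  \<open>p\<^sub>A p\<^sub>B = \<Sum>\<plusminus> p\<^bsub>A-h+g\<^esub> p\<^bsub>B-g+h\<^esub>\<close>, with \<open>g\<close> in \<open>B - A\<close> fixed and \<open>h\<close> ranging over \<open>A - B\<close>,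
  express \<open>z\<^sub>b z\<^sub>g\<close> for incomparable
  \<open>b, g\<close> through products whose first factor lies above \<open>b\<close> or whose second factor lies above
  \<open>g\<close>. Hence the support of a point has a unique maximum, and if that maximum \<open>b\<close> is one rank below
  \<open>d\<close>, then every tangent vector at the point to the Schubert variety of \<open>d\<close> with vanishing
  \<open>d\<close>-coordinate is tangent to that of \<open>b\<close>.

  The \<open>t\<^sub>i\<close> are chosen one after the other. As \<open>t \<rightarrow> 0\<close>, the hyperplane of \<open>t\<close> degenerates on the variety
  of \<open>d\<close> to \<open>z\<^sub>d = 0\<close>, whose intersection with it is a union of varieties of lower rank, where the
  intersections are transverse and real by induction. By compactness transversality
  persists for small \<open>t\<close>. A nonreal point near a real limit point would have its conjugate nearby as well,
  and the limiting secant would be a forbidden tangent vector. No count of points is needed.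
\<close>

section \<open>Real transversality by induction on the rank\<close>

lemma finite_coordinates_convergent_subseq:
  fixes z :: "nat \<Rightarrow> 'c \<Rightarrow> complex"
  assumes "finite C" "\<And>k c. c \<in> C \<Longrightarrow> cmod (z k c) \<le> K"
  shows "\<exists>r l. strict_mono r \<and> (\<forall>c\<in>C. (\<lambda>k. z (r k) c) \<longlonglongrightarrow> l c)"
  using assms
proof (induction C)
  case empty
  show ?case by (rule exI[of _ id]) (auto simp: strict_mono_def)
next
  case (insert a C)
  then obtain r l where r: "strict_mono r" "\<forall>c\<in>C. (\<lambda>k. z (r k) c) \<longlonglongrightarrow> l c"
    by auto
  have "bounded (range (\<lambda>k. z (r k) a))"
    using insert.prems by (auto simp: bounded_iff)
  then obtain b r' where r': "strict_mono (r' :: nat \<Rightarrow> nat)" "((\<lambda>k. z (r k) a) \<circ> r') \<longlonglongrightarrow> b"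
    using bounded_imp_convergent_subsequence by blast
  have "(\<lambda>k. z ((r \<circ> r') k) c) \<longlonglongrightarrow> (l(a := b)) c" if "c \<in> insert a C" for c
  proof (cases "c = a")
    case True
    then show ?thesis using r'(2) by (simp add: o_def)
  next
    case False
    with that r(2) have "(\<lambda>k. z (r k) c) \<longlonglongrightarrow> l c" by blast
    from LIMSEQ_subseq_LIMSEQ[OF this r'(1)] show ?thesis using False by (simp add: o_def)
  qed
  moreover have "strict_mono (r \<circ> r')" using r(1) r'(1) by (rule strict_mono_o)
  ultimately show ?case by blast
qed

lemma finite_has_max:
  fixes f :: "'a \<Rightarrow> nat"
  assumes "finite S" "S \<noteq> {}"
  obtains b where "b \<in> S" "\<And>c. c \<in> S \<Longrightarrow> f c \<le> f b"
proof -
  have "Max (f ` S) \<in> f ` S" using assms by simp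
  then obtain b where "b \<in> S" "f b = Max (f ` S)" by force
  then show thesis using that[of b] assms by simp
qed

text \<open>An abstraction of \<open>Cq\<close> with its quadrics. \<open>straighten\<close> speaks
  of ordered pairs: in every monomial other than the one at \<open>(b, g)\<close>, the first factor
  has moved strictly up from \<open>b\<close> or the second strictly up from \<open>g\<close>. The
  forms need not be symmetric, so the two slots keep these roles.\<close>

locale straightening_poset =
  fixes C :: "'c set" and le :: "'c \<Rightarrow> 'c \<Rightarrow> bool" and rk :: "'c \<Rightarrow> nat" and N :: nat
    and l :: "'c \<Rightarrow> real" and Rel :: "('c \<Rightarrow> 'c \<Rightarrow> real) set"
  assumes fin: "finite C"
    and le_refl: "c \<in> C \<Longrightarrow> le c c"
    and le_trans: "\<lbrakk>c \<in> C; d \<in> C; e \<in> C; le c d; le d e\<rbrakk> \<Longrightarrow> le c e"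
    and rk_strict: "\<lbrakk>c \<in> C; d \<in> C; le c d; c \<noteq> d\<rbrakk> \<Longrightarrow> rk c < rk d"
    and rk_le: "c \<in> C \<Longrightarrow> rk c \<le> N"
    and l_nonzero: "c \<in> C \<Longrightarrow> l c \<noteq> 0"
    and straighten: "\<lbrakk>b \<in> C; g \<in> C; \<not> le b g; \<not> le g b\<rbrakk> \<Longrightarrow>
      \<exists>B\<in>Rel. B b g \<noteq> 0 \<and> (\<forall>c\<in>C. \<forall>d\<in>C. B c d \<noteq> 0 \<longrightarrow>
        (c = b \<and> d = g) \<or> (le b c \<and> c \<noteq> b) \<or> (le g d \<and> d \<noteq> g))"
begin

text \<open>The coefficients are real, so conjugation preserves the zero locus. Without symmetry of
  \<open>B\<close>, the linearisation of \<open>bil B z z\<close> at \<open>x\<close> is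
  \<open>bil B v x + bil B x v\<close>.\<close>

definition bil :: "('c \<Rightarrow> 'c \<Rightarrow> real) \<Rightarrow> ('c \<Rightarrow> complex) \<Rightarrow> ('c \<Rightarrow> complex) \<Rightarrow> complex" where
  "bil B z w = (\<Sum>c\<in>C. \<Sum>d\<in>C. of_real (B c d) * z c * w d)"

definition Lam :: "real \<Rightarrow> ('c \<Rightarrow> complex) \<Rightarrow> complex" where
  "Lam t z = (\<Sum>c\<in>C. z c * of_real (l c) * of_real t ^ (N - rk c))"

definition supp_le :: "'c \<Rightarrow> ('c \<Rightarrow> complex) \<Rightarrow> bool" where
  "supp_le d z \<longleftrightarrow> (\<forall>c. z c \<noteq> 0 \<longrightarrow> c \<in> C \<and> le c d)"

definition V :: "'c \<Rightarrow> ('c \<Rightarrow> complex) set" where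
  "V d = {z. supp_le d z \<and> (\<forall>B\<in>Rel. bil B z z = 0)}"

text \<open>For \<open>x = y\<close> this is the tangent space of \<open>V d\<close> at \<open>x\<close>; in general it contains
  the secant direction \<open>x - y\<close>.\<close>
definition T :: "'c \<Rightarrow> ('c \<Rightarrow> complex) \<Rightarrow> ('c \<Rightarrow> complex) \<Rightarrow> ('c \<Rightarrow> complex) set" where
  "T d x y = {v. supp_le d v \<and> (\<forall>B\<in>Rel. bil B v x + bil B y v = 0)}"

definition W :: "(nat \<Rightarrow> real) \<Rightarrow> nat \<Rightarrow> ('c \<Rightarrow> complex) set" where
  "W t r = {z. \<forall>i\<in>{1..r}. Lam (t i) z = 0}"

text \<open>The l1 norm, used to normalise homogeneous vectors before a convergent subsequence is
  taken.\<close>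

definition mass :: "('c \<Rightarrow> complex) \<Rightarrow> real" where
  "mass z = (\<Sum>c\<in>C. cmod (z c))"

section \<open>Linearity, scaling and conjugation\<close>

lemma bil_lin1: "bil B (\<lambda>c. a * z c + b * z' c) w = a * bil B z w + b * bil B z' w"
  by (simp add: bil_def algebra_simps sum.distrib sum_distrib_left)

lemma bil_lin2: "bil B z (\<lambda>c. a * w c + b * w' c) = a * bil B z w + b * bil B z w'"
  by (simp add: bil_def algebra_simps sum.distrib sum_distrib_left)

lemma bil_scale1: "bil B (\<lambda>c. a * z c) w = a * bil B z w"
  using bil_lin1[of B a z 0 z] by simp

lemma bil_scale2: "bil B z (\<lambda>c. a * w c) = a * bil B z w"
  using bil_lin2[of B z a w 0 w] by simp

lemma Lam_lin: "Lam t (\<lambda>c. a * z c + b * z' c) = a * Lam t z + b * Lam t z'"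
  by (simp add: Lam_def algebra_simps sum.distrib sum_distrib_left)

lemma Lam_scale: "Lam t (\<lambda>c. a * z c) = a * Lam t z"
  using Lam_lin[of t a z 0 z] by simp

lemma bil_cnj: "bil B (\<lambda>c. cnj (z c)) (\<lambda>c. cnj (w c)) = cnj (bil B z w)"
  by (simp add: bil_def)

lemma Lam_cnj: "Lam t (\<lambda>c. cnj (z c)) = cnj (Lam t z)"
  by (simp add: Lam_def)

lemma V_scale: "z \<in> V d \<Longrightarrow> (\<lambda>c. a * z c) \<in> V d"
  by (auto simp: V_def supp_le_def bil_scale1 bil_scale2)

lemma V_cnj: "z \<in> V d \<Longrightarrow> (\<lambda>c. cnj (z c)) \<in> V d"
  by (auto simp: V_def supp_le_def bil_cnj)

lemma W_lin: "z \<in> W t r \<Longrightarrow> z' \<in> W t r \<Longrightarrow> (\<lambda>c. a * z c + b * z' c) \<in> W t r"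
  by (auto simp: W_def Lam_lin)

lemma W_scale: "z \<in> W t r \<Longrightarrow> (\<lambda>c. a * z c) \<in> W t r"
  by (auto simp: W_def Lam_scale)

lemma W_cnj: "z \<in> W t r \<Longrightarrow> (\<lambda>c. cnj (z c)) \<in> W t r"
  by (auto simp: W_def Lam_cnj)

lemma supp_le_lin: "supp_le d v \<Longrightarrow> supp_le d w \<Longrightarrow> supp_le d (\<lambda>c. a * v c + b * w c)"
  unfolding supp_le_def by (metis add_0 mult_zero_right)

lemma T_scale: "v \<in> T d x y \<Longrightarrow> (\<lambda>c. a * v c) \<in> T d x y"
  by (auto simp: T_def supp_le_def bil_scale1 bil_scale2 simp flip: distrib_left)

lemma T_lin: "v \<in> T d x y \<Longrightarrow> v' \<in> T d x y \<Longrightarrow> (\<lambda>c. a * v c + b * v' c) \<in> T d x y"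
proof -
  assume a: "v \<in> T d x y" "v' \<in> T d x y"
  have "bil B (\<lambda>c. a * v c + b * v' c) x + bil B y (\<lambda>c. a * v c + b * v' c)
      = a * (bil B v x + bil B y v) + b * (bil B v' x + bil B y v')" for B
    by (simp add: bil_lin1 bil_lin2 algebra_simps)
  then show ?thesis using a by (simp add: T_def supp_le_lin)
qed

lemma self_tangent: "x \<in> V d \<Longrightarrow> x \<in> T d x x"
  by (auto simp: V_def T_def)

lemma T_rescale_base: "v \<in> T d x x \<Longrightarrow> v \<in> T d (\<lambda>c. a * x c) (\<lambda>c. a * x c)"
  by (auto simp: T_def bil_scale1 bil_scale2 simp flip: distrib_left)

text \<open>With the base points in opposite slots the mixed terms cancel even for nonsymmetric
  \<open>B\<close>, and the condition telescopes to \<open>bil B x x - bil B y y\<close>.\<close>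

lemma secant: "x \<in> V d \<Longrightarrow> y \<in> V d \<Longrightarrow> (\<lambda>c. 1 * x c + (-1) * y c) \<in> T d x y"
proof -
  assume a: "x \<in> V d" "y \<in> V d"
  have "bil B (\<lambda>c. 1 * x c + (-1) * y c) x + bil B y (\<lambda>c. 1 * x c + (-1) * y c)
      = bil B x x - bil B y y" for B
    unfolding bil_lin1 bil_lin2 by simp
  moreover have "supp_le d (\<lambda>c. 1 * x c + (-1) * y c)"
    using a by (intro supp_le_lin) (auto simp: V_def)
  ultimately show ?thesis using a by (simp add: T_def V_def del: mult_1)
qed

lemma mass_scale: "mass (\<lambda>c. a * z c) = cmod a * mass z"
  by (simp add: mass_def norm_mult sum_distrib_left)

lemma mass_coord: "c \<in> C \<Longrightarrow> cmod (z c) \<le> mass z"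
  unfolding mass_def by (rule member_le_sum) (auto simp: fin)

lemma mass_pos: "supp_le d z \<Longrightarrow> z \<noteq> (\<lambda>c. 0) \<Longrightarrow> mass z > 0"
proof -
  assume a: "supp_le d z" "z \<noteq> (\<lambda>c. 0)"
  then obtain c where "z c \<noteq> 0" by auto
  then show ?thesis using a mass_coord[of c z] less_le_trans[of 0 "cmod (z c)" "mass z"]
    by (auto simp: supp_le_def)
qed

section \<open>Closedness under coordinatewise limits\<close>

lemma mass_limit:
  assumes "\<forall>c\<in>C. (\<lambda>k. z k c) \<longlonglongrightarrow> z' c" "\<And>k. mass (z k) = 1"
  shows "mass z' = 1"
proof -
  have "(\<lambda>k. mass (z k)) \<longlonglongrightarrow> mass z'"
    unfolding mass_def using assms(1) by (intro tendsto_sum tendsto_norm) auto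
  then show ?thesis using assms(2) by (simp add: LIMSEQ_const_iff)
qed

lemma bil_limit:
  assumes "\<forall>c\<in>C. (\<lambda>k. z k c) \<longlonglongrightarrow> z' c" "\<forall>c\<in>C. (\<lambda>k. w k c) \<longlonglongrightarrow> w' c"
  shows "(\<lambda>k. bil B (z k) (w k)) \<longlonglongrightarrow> bil B z' w'"
  unfolding bil_def using assms by (intro tendsto_sum tendsto_mult tendsto_const) auto

lemma W_limit:
  assumes "\<forall>c\<in>C. (\<lambda>k. z k c) \<longlonglongrightarrow> z' c" "\<And>k. z k \<in> W t r"
  shows "z' \<in> W t r"
proof -
  have "Lam (t i) z' = 0" if "i \<in> {1..r}" for i
  proof -
    have "(\<lambda>k. Lam (t i) (z k)) \<longlonglongrightarrow> Lam (t i) z'"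
      unfolding Lam_def using assms(1) by (intro tendsto_sum tendsto_mult tendsto_const) auto
    moreover have "Lam (t i) (z k) = 0" for k using assms(2)[of k] that by (auto simp: W_def)
    ultimately show ?thesis by (simp add: LIMSEQ_const_iff)
  qed
  then show ?thesis by (simp add: W_def)
qed

lemma supp_le_limit:
  assumes "\<forall>c\<in>C. (\<lambda>k. z k c) \<longlonglongrightarrow> z' c" "\<And>k. supp_le d (z k)" "\<And>c. c \<notin> C \<Longrightarrow> z' c = 0"
  shows "supp_le d z'"
proof -
  have "z' c = 0" if "c \<in> C" "\<not> le c d" for c
  proof -
    have "z k c = 0" for k using assms(2)[of k] that by (auto simp: supp_le_def)
    then show ?thesis using assms(1) that by (auto simp: LIMSEQ_const_iff)
  qed
  then show ?thesis using assms(3) by (auto simp: supp_le_def)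
qed

lemma T_limit:
  assumes "\<forall>c\<in>C. (\<lambda>k. x k c) \<longlonglongrightarrow> x' c" "\<forall>c\<in>C. (\<lambda>k. y k c) \<longlonglongrightarrow> y' c"
    and "\<forall>c\<in>C. (\<lambda>k. v k c) \<longlonglongrightarrow> v' c" "\<And>k. v k \<in> T d (x k) (y k)" "\<And>c. c \<notin> C \<Longrightarrow> v' c = 0"
  shows "v' \<in> T d x' y'"
proof -
  have "bil B v' x' + bil B y' v' = 0" if "B \<in> Rel" for B
  proof -
    have "(\<lambda>k. bil B (v k) (x k) + bil B (y k) (v k)) \<longlonglongrightarrow> bil B v' x' + bil B y' v'"
      using assms by (intro tendsto_add bil_limit)
    moreover have "bil B (v k) (x k) + bil B (y k) (v k) = 0" for k
      using assms(4)[of k] that by (auto simp: T_def)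
    ultimately show ?thesis by (simp add: LIMSEQ_const_iff)
  qed
  moreover have "supp_le d v'"
    by (rule supp_le_limit[OF assms(3)]) (use assms(4,5) in \<open>auto simp: T_def\<close>)
  ultimately show ?thesis by (simp add: T_def)
qed

text \<open>Up to a factor 2, the equations of \<open>V d\<close> at \<open>x\<close> say that
  \<open>x\<close> lies in \<open>T d x x\<close>, so the closedness of \<open>T\<close>
  applies.\<close>

lemma V_limit:
  assumes "\<forall>c\<in>C. (\<lambda>k. x k c) \<longlonglongrightarrow> x' c" "\<And>k. x k \<in> V d" "\<And>c. c \<notin> C \<Longrightarrow> x' c = 0"
  shows "x' \<in> V d"
  using T_limit[OF assms(1) assms(1) assms(1) self_tangent[OF assms(2)] assms(3)]
  by (auto simp: T_def V_def)

text \<open>On vectors supported below \<open>d\<close> the form \<open>Lam t\<close> is \<open>t ^ (N - rk d)\<close> times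
  \<open>l d * z d\<close> plus terms of positive order in \<open>t\<close>.\<close>
lemma top_coordinate_limit:
  assumes d: "d \<in> C" and t: "\<And>k. t k > 0" "t \<longlonglongrightarrow> 0"
    and z: "\<forall>c\<in>C. (\<lambda>k. z k c) \<longlonglongrightarrow> z' c" "\<And>k. supp_le d (z k)" "\<And>k. Lam (t k) (z k) = 0"
  shows "z' d = 0"
proof -
  define h where "h k c = z k c * of_real (l c) * of_real (t k) ^ (rk d - rk c)" for k c
  have "Lam (t k) (z k) = of_real (t k) ^ (N - rk d) * (\<Sum>c\<in>C. h k c)" for k
    unfolding Lam_def sum_distrib_left
  proof (rule sum.cong)
    fix c assume c: "c \<in> C"
    show "z k c * of_real (l c) * of_real (t k) ^ (N - rk c) = of_real (t k) ^ (N - rk d) * h k c"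
    proof (cases "z k c = 0")
      case False
      then have "le c d" using z(2)[of k] by (auto simp: supp_le_def)
      then have "rk c \<le> rk d" using rk_strict[OF c d] by (cases "c = d") auto
      \<comment> \<open>The differences are truncated; \<open>rk c <= rk d <= N\<close> makes the
        splitting exact.\<close>
      then have "N - rk c = (N - rk d) + (rk d - rk c)" using rk_le[OF d] by simp
      then show ?thesis by (simp add: h_def power_add)
    qed (simp add: h_def)
  qed simp
  then have 0: "(\<Sum>c\<in>C. h k c) = 0" for k using z(3)[of k] t(1)[of k] by simp
  have "(\<lambda>k. h k c) \<longlonglongrightarrow> (if c = d then z' d * of_real (l d) else 0)" if c: "c \<in> C" for c
  proof (cases "c = d")
    case True
    then show ?thesis unfolding h_def using z(1) d by (auto intro!: tendsto_intros)
  next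
    case False
    show ?thesis
    proof (cases "le c d")
      case True
      then have pos: "rk d - rk c > 0" using rk_strict[OF c d] False by auto
      have "(\<lambda>k. h k c) \<longlonglongrightarrow> z' c * of_real (l c) * of_real 0 ^ (rk d - rk c)"
        unfolding h_def using z(1) c t(2) by (intro tendsto_intros) auto
      then show ?thesis using False pos by (simp add: power_0_left)
    next
      case nle: False
      have "h k c = 0" for k using z(2)[of k] nle by (auto simp: supp_le_def h_def)
      then show ?thesis using False by simp
    qed
  qed
  then have "(\<lambda>k. \<Sum>c\<in>C. h k c) \<longlonglongrightarrow> (\<Sum>c\<in>C. if c = d then z' d * of_real (l d) else 0)"
    by (intro tendsto_sum) auto
  then have "z' d * of_real (l d) = 0" unfolding 0 using d fin by (simp add: LIMSEQ_const_iff)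
  then show ?thesis using l_nonzero[OF d] by simp
qed

section \<open>Leading coordinates and tangent vectors under straightening\<close>

lemma bil_single:
  assumes "b \<in> C" "g \<in> C" "\<And>c d. \<lbrakk>c \<in> C; d \<in> C; B c d \<noteq> 0; \<not> (c = b \<and> d = g)\<rbrakk> \<Longrightarrow> z c * w d = 0"
  shows "bil B z w = of_real (B b g) * z b * w g"
proof -
  have "bil B z w = (\<Sum>c\<in>C. \<Sum>d\<in>C. if d = g then if c = b then of_real (B b g) * z b * w g else 0 else 0)"
    unfolding bil_def
  proof (intro sum.cong refl)
    fix c d assume "c \<in> C" "d \<in> C"
    then show "of_real (B c d) * z c * w d =
      (if d = g then if c = b then of_real (B b g) * z b * w g else 0 else 0)"
      using assms(3)[of c d] by (cases "B c d = 0") auto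
  qed
  then show ?thesis using assms(1,2) fin by simp
qed

text \<open>Take \<open>b\<close> of maximal rank in the support and, if some support element is not
  below \<open>b\<close>, take \<open>g\<close> of maximal rank among those. The straightening
  relation of \<open>b\<close> and \<open>g\<close> then collapses to \<open>x b * x g = 0\<close>,
  a contradiction.\<close>

lemma max_support:
  assumes "x \<in> V d" "x \<noteq> (\<lambda>c. 0)"
  obtains b where "b \<in> C" "x b \<noteq> 0" "le b d" "x \<in> V b"
proof -
  define S where "S = {c \<in> C. x c \<noteq> 0}"
  have finS: "finite S" using fin by (simp add: S_def)
  obtain c where "x c \<noteq> 0" using assms(2) by auto
  then have "S \<noteq> {}" using assms by (auto simp: S_def V_def supp_le_def)
  then obtain b where b: "b \<in> S" "\<And>c. c \<in> S \<Longrightarrow> rk c \<le> rk b"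
    using finite_has_max[of S rk] finS by metis
  have bC: "b \<in> C" "x b \<noteq> 0" using b by (auto simp: S_def)
  have "le g b" if "g \<in> S" for g
  proof (rule ccontr)
    assume ng: "\<not> le g b"
    define S' where "S' = {c \<in> S. \<not> le c b}"
    have "finite S'" "S' \<noteq> {}" using finS that ng by (auto simp: S'_def)
    then obtain g where g: "g \<in> S'" "\<And>c. c \<in> S' \<Longrightarrow> rk c \<le> rk g"
      using finite_has_max[of S' rk] by metis
    have gC: "g \<in> C" "x g \<noteq> 0" "\<not> le g b" "g \<in> S" using g by (auto simp: S_def S'_def)
    \<comment> \<open>By maximality of rank, \<open>le b g\<close> would force \<open>b = g\<close>,
      but then \<open>g\<close> would lie below \<open>b\<close>.\<close>
    have nbg: "\<not> le b g"
      using rk_strict[OF bC(1) gC(1)] b(2)[OF gC(4)] gC(3) le_refl[OF bC(1)] by auto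
    obtain B where B: "B \<in> Rel" "B b g \<noteq> 0" "\<And>c d. \<lbrakk>c \<in> C; d \<in> C; B c d \<noteq> 0\<rbrakk> \<Longrightarrow>
        (c = b \<and> d = g) \<or> (le b c \<and> c \<noteq> b) \<or> (le g d \<and> d \<noteq> g)"
      using straighten[OF bC(1) gC(1) nbg gC(3)] by blast
    have above_b: "x c = 0" if "c \<in> C" "le b c" "c \<noteq> b" for c
      using rk_strict[OF bC(1) that(1)] that b(2)[of c] by (cases "x c = 0") (auto simp: S_def)
    \<comment> \<open>Whatever lies above \<open>g\<close> is again not below \<open>b\<close>, so a
      nonzero coordinate there would contradict the choice of \<open>g\<close>.\<close>
    have above_g: "x c = 0" if "c \<in> C" "le g c" "c \<noteq> g" for c
      using rk_strict[OF gC(1) that(1)] that g(2)[of c] le_trans[OF gC(1) that(1) bC(1)] gC(3)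
      by (cases "x c = 0") (auto simp: S'_def S_def)
    have "x c * x d = 0" if "c \<in> C" "d \<in> C" "B c d \<noteq> 0" "\<not> (c = b \<and> d = g)" for c d
      using B(3)[OF that(1-3)] that(4) above_b[OF that(1)] above_g[OF that(2)] by auto
    then have "bil B x x = of_real (B b g) * x b * x g"
      by (rule bil_single[OF bC(1) gC(1)])
    moreover have "bil B x x = 0" using assms(1) B(1) by (simp add: V_def)
    ultimately show False using B(2) bC(2) gC(2) by simp
  qed
  then have "x \<in> V b" using assms(1) by (auto simp: V_def supp_le_def S_def)
  moreover have "le b d" using bC assms(1) by (auto simp: V_def supp_le_def)
  ultimately show thesis using that bC by blast
qed

text \<open>The argument of \<open>max_support\<close> for the linearised relation: with
  \<open>g\<close> of maximal rank in the support of \<open>v\<close> among the elements not below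
  \<open>b\<close>, it reduces to \<open>x b * v g = 0\<close>, since \<open>x\<close> is supported
  below \<open>b\<close> and so \<open>x g = 0\<close>.\<close>

lemma tangent_restricts:
  assumes b: "b \<in> C" "x b \<noteq> 0" "x \<in> V b" and d: "d \<in> C" "rk d = Suc (rk b)" "le b d"
    and v: "v \<in> T d x x" "v d = 0"
  shows "v \<in> T b x x"
proof -
  define S where "S = {c \<in> C. v c \<noteq> 0 \<and> \<not> le c b}"
  have x: "le c b" if "x c \<noteq> 0" for c using b(3) that by (auto simp: V_def supp_le_def)
  have "S = {}"
  proof (rule ccontr)
    assume "S \<noteq> {}"
    moreover have "finite S" using fin by (simp add: S_def)
    ultimately obtain g where g: "g \<in> S" "\<And>c. c \<in> S \<Longrightarrow> rk c \<le> rk g"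
      using finite_has_max[of S rk] by metis
    have gC: "g \<in> C" "v g \<noteq> 0" "\<not> le g b" using g by (auto simp: S_def)
    \<comment> \<open>The rank gap of one enters here: no element other than \<open>d\<close> lies
      both strictly above \<open>b\<close> and below \<open>d\<close>, and \<open>v\<close> vanishes
      at \<open>d\<close>.\<close>
    have above_b: "v c = 0 \<and> x c = 0" if c: "c \<in> C" "le b c" "c \<noteq> b" for c
    proof
      have r: "rk b < rk c" using rk_strict[OF b(1) c(1)] c by auto
      then show "x c = 0" using x[of c] rk_strict[OF c(1) b(1)] c(3) by auto
      show "v c = 0"
      proof (rule ccontr)
        assume "v c \<noteq> 0"
        then have "le c d" "c \<noteq> d" using v by (auto simp: T_def supp_le_def)
        then show False using rk_strict[OF c(1) d(1)] r d(2) by auto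
      qed
    qed
    have above_g: "v c = 0 \<and> x c = 0" if c: "c \<in> C" "le g c" "c \<noteq> g" for c
    proof -
      have n: "\<not> le c b" using le_trans[OF gC(1) c(1) b(1)] c gC by auto
      then show ?thesis using x[of c] g(2)[of c] rk_strict[OF gC(1) c(1)] c by (auto simp: S_def)
    qed
    have nbg: "\<not> le b g" using above_b[of g] gC le_refl by auto
    obtain B where B: "B \<in> Rel" "B b g \<noteq> 0" "\<And>c d. \<lbrakk>c \<in> C; d \<in> C; B c d \<noteq> 0\<rbrakk> \<Longrightarrow>
        (c = b \<and> d = g) \<or> (le b c \<and> c \<noteq> b) \<or> (le g d \<and> d \<noteq> g)"
      using straighten[OF b(1) gC(1) nbg gC(3)] by blast
    have zero: "x c * v d = 0" "v c * x d = 0"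
      if "c \<in> C" "d \<in> C" "B c d \<noteq> 0" "\<not> (c = b \<and> d = g)" for c d
      using B(3)[OF that(1-3)] that(4) above_b[OF that(1)] above_g[OF that(2)] by auto
    have "bil B x v = of_real (B b g) * x b * v g"
      using zero(1) by (rule bil_single[OF b(1) gC(1)])
    moreover have "bil B v x = of_real (B b g) * v b * x g"
      using zero(2) by (rule bil_single[OF b(1) gC(1)])
    moreover have "x g = 0" using x gC by blast
    moreover have "bil B v x + bil B x v = 0" using v(1) B(1) by (simp add: T_def)
    ultimately show False using B(2) b(2) gC(2) by simp
  qed
  then show ?thesis using v by (auto simp: T_def supp_le_def S_def)
qed

text \<open>The induction invariant for the first \<open>r\<close> hyperplanes. The clause on ranks
  below \<open>r\<close> replaces dimension theory: it keeps limit points from degenerating by more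
  than one rank.\<close>

definition good :: "(nat \<Rightarrow> real) \<Rightarrow> nat \<Rightarrow> bool" where
  "good t r \<longleftrightarrow>
    (\<forall>d\<in>C. rk d < r \<longrightarrow> V d \<inter> W t r \<subseteq> {\<lambda>c. 0}) \<and>
    (\<forall>d\<in>C. rk d = r \<longrightarrow> (\<forall>x\<in>V d \<inter> W t r. x \<noteq> (\<lambda>c. 0) \<longrightarrow>
       T d x x \<inter> W t r \<subseteq> range (\<lambda>u c. u * x c) \<and> real_point x))"

lemma good_proper:
  "\<lbrakk>good t r; d \<in> C; rk d < r; x \<in> V d \<inter> W t r\<rbrakk> \<Longrightarrow> x = (\<lambda>c. 0)"
  unfolding good_def by blast

lemma good_transverse:
  "\<lbrakk>good t r; d \<in> C; rk d = r; x \<in> V d \<inter> W t r; x \<noteq> (\<lambda>c. 0)\<rbrakk> \<Longrightarrow>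
    T d x x \<inter> W t r \<subseteq> range (\<lambda>u c. u * x c) \<and> real_point x"
  unfolding good_def by blast

text \<open>Nothing lies strictly below an element of rank 0, so all vectors involved lie on one
  coordinate line.\<close>

lemma good_0: "good t 0"
proof -
  have "T d x x \<subseteq> range (\<lambda>u c. u * x c) \<and> real_point x"
    if d: "d \<in> C" "rk d = 0" and x: "x \<in> V d" "x \<noteq> (\<lambda>c. 0)" for d x
  proof -
    have z: "z c = 0" if "supp_le d z" "c \<noteq> d" for z c
      using that rk_strict[of c d] d by (auto simp: supp_le_def)
    have "supp_le d x" using x by (simp add: V_def)
    then have xd: "x d \<noteq> 0" using x(2) z[of x] by metis
    have "v = (\<lambda>c. v d / x d * x c)" if "v \<in> T d x x" for v
    proof
      fix c show "v c = v d / x d * x c"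
        using z[of v c] z[of x c] that x xd by (cases "c = d") (auto simp: V_def T_def)
    qed
    then have "T d x x \<subseteq> range (\<lambda>u c. u * x c)" by blast
    moreover have "\<forall>c. x c = x d * of_real (if c = d then 1 else 0)"
      using z[of x] x by (auto simp: V_def)
    then have "real_point x" unfolding real_point_def
      by (intro exI[of _ "x d"] exI[of _ "\<lambda>c. if c = d then 1 else 0"])
    ultimately show ?thesis ..
  qed
  then show ?thesis by (auto simp: good_def)
qed

text \<open>Rescaling to mass 1 guarantees a nonzero limit. The scalars \<open>a\<close> are
  returned because the same subsequence is renormalised later by another coordinate.\<close>

lemma projective_limit:
  assumes "\<And>k. x k \<in> V d \<inter> W t r" "\<And>k. x k \<noteq> (\<lambda>c. 0)"
    and d: "d \<in> C" and s: "\<And>k. s k > 0" "s \<longlonglongrightarrow> 0" "\<And>k. Lam (s k) (x k) = 0"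
  obtains \<phi> a x' where "strict_mono \<phi>" "\<forall>c\<in>C. (\<lambda>k. a k * x (\<phi> k) c) \<longlonglongrightarrow> x' c" "\<forall>k. a k \<noteq> 0"
    "x' \<in> V d \<inter> W t r" "x' \<noteq> (\<lambda>c. 0)" "x' d = 0"
proof -
  define a where "a k = complex_of_real (1 / mass (x k))" for k
  define y where "y k = (\<lambda>c. a k * x k c)" for k
  have m: "mass (x k) > 0" for k
    by (rule mass_pos[of d]) (use assms(1)[of k] assms(2)[of k] in \<open>auto simp: V_def\<close>)
  then have a: "a k \<noteq> 0" for k by (simp add: a_def less_imp_neq[symmetric])
  have mass: "mass (y k) = 1" for k
    unfolding y_def mass_scale a_def using m[of k] by (simp add: norm_divide)
  have "cmod (y k c) \<le> 1" if "c \<in> C" for k c using mass_coord[OF that, of "y k"] mass[of k] by simp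
  from finite_coordinates_convergent_subseq[of C y 1, OF fin this] obtain \<phi> x0 where
    \<phi>: "strict_mono \<phi>" "\<forall>c\<in>C. (\<lambda>k. y (\<phi> k) c) \<longlonglongrightarrow> x0 c" by blast
  \<comment> \<open>The subsequence controls only the coordinates in \<open>C\<close>; the others
    are set to 0.\<close>
  define x' where "x' c = (if c \<in> C then x0 c else 0)" for c
  have x': "\<forall>c\<in>C. (\<lambda>k. y (\<phi> k) c) \<longlonglongrightarrow> x' c" using \<phi> by (simp add: x'_def)
  have y: "y k \<in> V d" "y k \<in> W t r" "Lam (s k) (y k) = 0" for k
    using assms(1)[of k] s(3)[of k] by (auto simp: y_def V_scale W_scale Lam_scale)
  have "x' \<in> V d" by (rule V_limit[OF x']) (auto simp: y x'_def)
  moreover have "x' \<in> W t r" by (rule W_limit[OF x']) (rule y)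
  moreover have "mass x' = 1" by (rule mass_limit[OF x']) (rule mass)
  then have "x' \<noteq> (\<lambda>c. 0)" by (auto simp: mass_def)
  moreover have "x' d = 0"
  proof (rule top_coordinate_limit[OF d _ _ x'])
    show "(s \<circ> \<phi>) k > 0" for k using s by simp
    show "(s \<circ> \<phi>) \<longlonglongrightarrow> 0" using s(2) \<phi>(1) by (rule LIMSEQ_subseq_LIMSEQ)
    show "supp_le d (y (\<phi> k))" for k using y(1) by (auto simp: V_def)
    show "Lam ((s \<circ> \<phi>) k) (y (\<phi> k)) = 0" for k using y(3) by simp
  qed
  ultimately show thesis using that[of \<phi> "a \<circ> \<phi>" x'] \<phi>(1) x' a by (simp add: y_def)
qed

text \<open>A secant or tangent direction that survives in the limit lies in the tangent space of \<open>V b\<close>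
  by \<open>tangent_restricts\<close>, against transversality one rank lower. Normalising the coordinate
  \<open>b\<close> to 0 excludes multiples of \<open>x'\<close>.\<close>
lemma no_secants_near:
  assumes good: "good t r" and d: "d \<in> C" "rk d = Suc r" and s: "\<And>k. s k > 0" "s \<longlonglongrightarrow> 0"
    and b: "b \<in> C" "rk b = r" "le b d" "x' \<in> V b \<inter> W t r" "x' b \<noteq> 0"
    and x: "\<forall>c\<in>C. (\<lambda>k. x k c) \<longlonglongrightarrow> x' c" and y: "\<forall>c\<in>C. (\<lambda>k. y k c) \<longlonglongrightarrow> x' c"
    and u: "\<And>k. u k \<in> T d (x k) (y k) \<inter> W t r" "\<And>k. Lam (s k) (u k) = 0"
      "\<And>k. u k b = 0" "\<And>k. u k \<noteq> (\<lambda>c. 0)"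
  shows False
proof -
  define a where "a k = complex_of_real (1 / mass (u k))" for k
  define v where "v k = (\<lambda>c. a k * u k c)" for k
  have m: "mass (u k) > 0" for k
    by (rule mass_pos[of d]) (use u(1)[of k] u(4)[of k] in \<open>auto simp: T_def\<close>)
  have mass: "mass (v k) = 1" for k
    unfolding v_def a_def mass_scale using m[of k] by (simp add: norm_divide)
  have "cmod (v k c) \<le> 1" if "c \<in> C" for k c using mass_coord[OF that, of "v k"] mass[of k] by simp
  from finite_coordinates_convergent_subseq[of C v 1, OF fin this] obtain \<phi> v0 where
    \<phi>: "strict_mono \<phi>" "\<forall>c\<in>C. (\<lambda>k. v (\<phi> k) c) \<longlonglongrightarrow> v0 c" by blast
  define v' where "v' c = (if c \<in> C then v0 c else 0)" for c
  have v': "\<forall>c\<in>C. (\<lambda>k. v (\<phi> k) c) \<longlonglongrightarrow> v' c" using \<phi> by (simp add: v'_def)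
  have v: "v k \<in> T d (x k) (y k)" "v k \<in> W t r" "Lam (s k) (v k) = 0" "v k b = 0" for k
    using u(1)[of k] u(2)[of k] u(3)[of k] unfolding v_def
    by (auto simp: Lam_scale intro: T_scale W_scale)
  have "v' \<in> T d x' x'"
  proof (rule T_limit[OF _ _ v'])
    show "\<forall>c\<in>C. (\<lambda>k. x (\<phi> k) c) \<longlonglongrightarrow> x' c" "\<forall>c\<in>C. (\<lambda>k. y (\<phi> k) c) \<longlonglongrightarrow> x' c"
      using x y LIMSEQ_subseq_LIMSEQ[OF _ \<phi>(1)] by (auto simp: o_def)
  qed (auto simp: v v'_def)
  moreover have "v' d = 0"
  proof (rule top_coordinate_limit[OF d(1) _ _ v'])
    show "(s \<circ> \<phi>) k > 0" for k using s by simp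
    show "(s \<circ> \<phi>) \<longlonglongrightarrow> 0" using s(2) \<phi>(1) by (rule LIMSEQ_subseq_LIMSEQ)
    show "supp_le d (v (\<phi> k))" for k using v(1) by (auto simp: T_def)
    show "Lam ((s \<circ> \<phi>) k) (v (\<phi> k)) = 0" for k using v(3) by simp
  qed
  ultimately have "v' \<in> T b x' x'" using tangent_restricts b d by auto
  moreover have "v' \<in> W t r" by (rule W_limit[OF v']) (rule v)
  moreover have "T b x' x' \<inter> W t r \<subseteq> range (\<lambda>u c. u * x' c)"
    using good_transverse[OF good b(1,2,4)] b(5) by auto
  ultimately obtain w where w: "v' = (\<lambda>c. w * x' c)" by auto
  have "(\<lambda>k. v (\<phi> k) b) \<longlonglongrightarrow> v' b" using v' b(1) by blast
  then have "v' b = 0" by (simp add: v LIMSEQ_const_iff)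
  then have "v' = (\<lambda>c. 0)" using w b(5) by simp
  moreover have "mass v' = 1" by (rule mass_limit[OF v']) (rule mass)
  ultimately show False by (simp add: mass_def)
qed

text \<open>Turns a claim about all small parameters into the refutation of a sequence of
  counterexamples, to which compactness applies.\<close>

lemma eventually_at_right_0_by_sequences:
  fixes P :: "real \<Rightarrow> bool"
  assumes "\<And>s. (\<And>k. s k > 0) \<Longrightarrow> s \<longlonglongrightarrow> 0 \<Longrightarrow> (\<And>k. \<not> P (s k)) \<Longrightarrow> False"
  shows "eventually P (at_right 0)"
proof (rule ccontr)
  assume "\<not> eventually P (at_right 0)"
  then have "\<exists>s>0. s < b \<and> \<not> P s" if "b > 0" for b
    using that by (auto simp: eventually_at_right_field)
  then have "\<forall>k. \<exists>s>0. s < 1 / real (Suc k) \<and> \<not> P s" by simp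
  then obtain s where s: "\<And>k. s k > 0" "\<And>k. s k < 1 / real (Suc k)" "\<And>k. \<not> P (s k)" by metis
  have "s \<longlonglongrightarrow> 0"
    by (rule tendsto_sandwich[OF _ _ tendsto_const LIMSEQ_inverse_real_of_nat])
       (use s in \<open>auto intro!: always_eventually simp: inverse_eq_divide less_imp_le\<close>)
  then show False using assms s by blast
qed

lemma W_Suc: "W (t(Suc r := s)) (Suc r) = {z \<in> W t r. Lam s z = 0}"
  by (auto simp: W_def atLeastAtMostSuc_conv)

text \<open>Counterexamples for parameters tending to 0 would have a nonzero limit with vanishing
  coordinate \<open>d\<close>. Its leading element has rank below \<open>rk d\<close>, hence below
  \<open>r\<close>, which \<open>good t r\<close> excludes.\<close>

lemma eventually_proper:
  assumes "good t r" "d \<in> C" "rk d \<le> r"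
  shows "\<forall>\<^sub>F s in at_right 0. V d \<inter> W (t(Suc r := s)) (Suc r) \<subseteq> {\<lambda>c. 0}"
proof (rule eventually_at_right_0_by_sequences)
  fix s assume s: "\<And>k. s k > (0::real)" "s \<longlonglongrightarrow> 0"
    "\<And>k. \<not> V d \<inter> W (t(Suc r := s k)) (Suc r) \<subseteq> {\<lambda>c. 0}"
  have "\<exists>x. x \<in> V d \<inter> W t r \<and> Lam (s k) x = 0 \<and> x \<noteq> (\<lambda>c. 0)" for k
    using s(3)[of k] by (auto simp: W_Suc)
  then obtain x where x: "\<And>k. x k \<in> V d \<inter> W t r" "\<And>k. Lam (s k) (x k) = 0" "\<And>k. x k \<noteq> (\<lambda>c. 0)"
    by metis
  obtain x' where x': "x' \<in> V d \<inter> W t r" "x' \<noteq> (\<lambda>c. 0)" "x' d = 0"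
    by (rule projective_limit[OF x(1) x(3) assms(2) s(1,2) x(2)]) (rule that; assumption)
  obtain b where b: "b \<in> C" "x' b \<noteq> 0" "le b d" "x' \<in> V b"
    using max_support x' by blast
  then have "rk b < rk d" using rk_strict[of b d] assms(2) x'(3) by auto
  then show False using good_proper[OF assms(1) b(1), of x'] assms(3) b x' by auto
qed

text \<open>Points violating transversality or reality accumulate at a point of a variety one rank
  lower. Each supplies a tangent or secant direction there, in the form that
  \<open>no_secants_near\<close> refutes.\<close>

lemma eventually_transverse:
  assumes good: "good t r" and d: "d \<in> C" "rk d = Suc r"
  shows "\<forall>\<^sub>F s in at_right 0. \<forall>x\<in>V d \<inter> W (t(Suc r := s)) (Suc r). x \<noteq> (\<lambda>c. 0) \<longrightarrow>
       T d x x \<inter> W (t(Suc r := s)) (Suc r) \<subseteq> range (\<lambda>u c. u * x c) \<and> real_point x"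
proof (rule eventually_at_right_0_by_sequences)
  let ?W = "\<lambda>s. W (t(Suc r := s)) (Suc r)"
  fix s assume s: "\<And>k. s k > (0::real)" "s \<longlonglongrightarrow> 0"
    "\<And>k. \<not> (\<forall>x\<in>V d \<inter> ?W (s k). x \<noteq> (\<lambda>c. 0) \<longrightarrow>
       T d x x \<inter> ?W (s k) \<subseteq> range (\<lambda>u c. u * x c) \<and> real_point x)"
  define bad where "bad k x \<longleftrightarrow>
    \<not> (T d x x \<inter> ?W (s k) \<subseteq> range (\<lambda>u c. u * x c) \<and> real_point x)" for k x
  have "\<exists>x. x \<in> V d \<inter> ?W (s k) \<and> x \<noteq> (\<lambda>c. 0) \<and> bad k x" for k
    using s(3)[of k] unfolding bad_def by blast
  then obtain x where x: "\<And>k. x k \<in> V d \<inter> ?W (s k)" "\<And>k. x k \<noteq> (\<lambda>c. 0)" "\<And>k. bad k (x k)"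
    by metis
  have xW: "\<And>k. x k \<in> V d \<inter> W t r" "\<And>k. Lam (s k) (x k) = 0" using x(1) by (auto simp: W_Suc)
  obtain \<phi> a x' where \<phi>: "strict_mono \<phi>" and lim: "\<forall>c\<in>C. (\<lambda>k. a k * x (\<phi> k) c) \<longlonglongrightarrow> x' c"
    and a: "\<forall>k. a k \<noteq> 0" and x': "x' \<in> V d \<inter> W t r" "x' \<noteq> (\<lambda>c. 0)" "x' d = 0"
    by (rule projective_limit[OF xW(1) x(2) d(1) s(1,2) xW(2)]) (rule that; assumption)
  obtain b where b: "b \<in> C" "x' b \<noteq> 0" "le b d" "x' \<in> V b"
    using max_support x' by blast
  have "rk b < rk d" using rk_strict[of b d] d x'(3) b by auto
  moreover have "\<not> rk b < r" using good_proper[OF good b(1), of x'] b x' by auto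
  \<comment> \<open>The limit thus degenerates by exactly one rank, as
    \<open>tangent_restricts\<close> requires.\<close>
  ultimately have rb: "rk b = r" using d(2) by simp
  \<comment> \<open>Normalised to \<open>z b = 1\<close>, the real limit is fixed by conjugation, so
    nearby points and their conjugates both converge to it.\<close>
  define z where "z = (\<lambda>c. inverse (x' b) * x' c)"
  have z: "z \<in> V b \<inter> W t r" "z b = 1"
    using b x' by (auto simp: z_def V_scale W_scale)
  have "real_point x'" using good_transverse[OF good b(1) rb, of x'] b x' by auto
  then obtain w f where wf: "\<And>c. x' c = w * complex_of_real (f c)" by (auto simp: real_point_def)
  have z_real: "cnj (z c) = z c" for c
    using b(2) unfolding z_def wf by (simp add: field_simps)
  have ev: "\<forall>\<^sub>F k in sequentially. a k * x (\<phi> k) b \<noteq> 0"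
    using tendsto_imp_eventually_ne[OF bspec[OF lim b(1)] b(2)] .
  then obtain K where K: "\<And>k. k \<ge> K \<Longrightarrow> x (\<phi> k) b \<noteq> 0" by (auto simp: eventually_sequentially)
  \<comment> \<open>The shift by \<open>K\<close> discards the indices at which coordinate
    \<open>b\<close> may vanish.\<close>
  define \<psi> where "\<psi> k = \<phi> (k + K)" for k
  define X where "X k = (\<lambda>c. inverse (x (\<psi> k) b) * x (\<psi> k) c)" for k
  have nz: "x (\<psi> k) b \<noteq> 0" for k using K by (simp add: \<psi>_def)
  have X: "X k \<in> V d" "X k \<in> ?W (s (\<psi> k))" "X k b = 1" for k
    using x(1)[of "\<psi> k"] nz[of k] by (auto simp: X_def V_scale W_scale)
  have X_lim: "\<forall>c\<in>C. (\<lambda>k. X k c) \<longlonglongrightarrow> z c"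
  proof
    fix c assume c: "c \<in> C"
    have "(\<lambda>k. inverse (a k * x (\<phi> k) b) * (a k * x (\<phi> k) c)) \<longlonglongrightarrow> inverse (x' b) * x' c"
      by (intro tendsto_mult tendsto_inverse) (use lim b c in auto)
    then have "(\<lambda>k. inverse (x (\<phi> k) b) * x (\<phi> k) c) \<longlonglongrightarrow> z c"
      using a by (simp add: z_def field_simps)
    then show "(\<lambda>k. X k c) \<longlonglongrightarrow> z c"
      unfolding X_def \<psi>_def by (rule LIMSEQ_ignore_initial_segment)
  qed
  have "\<exists>y u. (y = X k \<or> y = (\<lambda>c. cnj (X k c))) \<and> u \<in> T d (X k) y \<and> u \<in> ?W (s (\<psi> k))
      \<and> u b = 0 \<and> u \<noteq> (\<lambda>c. 0)" for k
  proof (cases "real_point (x (\<psi> k))")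
    case True
    then obtain v where v: "v \<in> T d (x (\<psi> k)) (x (\<psi> k))" "v \<in> ?W (s (\<psi> k))"
      "v \<notin> range (\<lambda>u c. u * x (\<psi> k) c)" using x(3)[of "\<psi> k"] by (auto simp: bad_def)
    \<comment> \<open>Subtracting a multiple of the point clears coordinate \<open>b\<close>; the
      result is nonzero because \<open>v\<close> is off the line through the point.\<close>
    define u where "u = (\<lambda>c. 1 * v c + (- v b) * X k c)"
    have "v \<in> T d (X k) (X k)" unfolding X_def using v(1) by (rule T_rescale_base)
    then have "u \<in> T d (X k) (X k)" unfolding u_def by (rule T_lin) (rule self_tangent[OF X(1)])
    moreover have "u \<in> ?W (s (\<psi> k))" unfolding u_def using v(2) X(2) by (rule W_lin)
    moreover have "u b = 0" using X(3) by (simp add: u_def)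
    moreover have "u \<noteq> (\<lambda>c. 0)"
    proof
      assume u0: "u = (\<lambda>c. 0)"
      have "v c = (v b * inverse (x (\<psi> k) b)) * x (\<psi> k) c" for c
        using fun_cong[OF u0, of c] by (simp add: u_def X_def mult.assoc)
      then show False using v(3) by blast
    qed
    ultimately show ?thesis by blast
  next
    case False
    define y where "y = (\<lambda>c. cnj (X k c))"
    \<comment> \<open>Both endpoints have coordinate \<open>b\<close> equal to 1, so it cancels; a
      zero difference would make the point real.\<close>
    define u where "u = (\<lambda>c. 1 * X k c + (-1) * y c)"
    have "u \<in> T d (X k) y" unfolding u_def by (rule secant) (auto simp: y_def X V_cnj)
    moreover have "u \<in> ?W (s (\<psi> k))" unfolding u_def by (rule W_lin) (auto simp: y_def X W_cnj)
    moreover have "u b = 0" by (simp add: u_def y_def X)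
    moreover have "u \<noteq> (\<lambda>c. 0)"
    proof
      assume u0: "u = (\<lambda>c. 0)"
      have "X k c = of_real (Re (X k c))" for c
        using fun_cong[OF u0, of c] by (simp add: u_def y_def complex_eq_iff)
      moreover have "x (\<psi> k) c = x (\<psi> k) b * X k c" for c
        using nz[of k] by (simp add: X_def)
      ultimately have "\<forall>c. x (\<psi> k) c = x (\<psi> k) b * of_real (Re (X k c))" by metis
      then have "real_point (x (\<psi> k))" unfolding real_point_def
        by (intro exI[of _ "x (\<psi> k) b"] exI[of _ "\<lambda>c. Re (X k c)"])
      then show False using False by simp
    qed
    ultimately show ?thesis unfolding y_def by blast
  qed
  then obtain y u where y: "\<And>k. y k = X k \<or> y k = (\<lambda>c. cnj (X k c))"
    and u: "\<And>k. u k \<in> T d (X k) (y k)" "\<And>k. u k \<in> ?W (s (\<psi> k))" "\<And>k. u k b = 0" "\<And>k. u k \<noteq> (\<lambda>c. 0)"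
    by metis
  have y_lim: "\<forall>c\<in>C. (\<lambda>k. y k c) \<longlonglongrightarrow> z c"
  proof
    fix c assume c: "c \<in> C"
    have "norm (y k c - z c) = norm (X k c - z c)" for k
      using y[of k] z_real[of c] complex_mod_cnj[of "X k c - z c"] by auto
    moreover have "(\<lambda>k. norm (X k c - z c)) \<longlonglongrightarrow> 0"
      using X_lim c by (intro tendsto_norm_zero LIM_zero) auto
    ultimately have "(\<lambda>k. norm (y k c - z c)) \<longlonglongrightarrow> 0" by simp
    then show "(\<lambda>k. y k c) \<longlonglongrightarrow> z c"
      by (rule tendsto_norm_zero_cancel[THEN LIM_zero_cancel])
  qed
  have s': "(\<lambda>k. s (\<psi> k)) \<longlonglongrightarrow> 0"
    using LIMSEQ_ignore_initial_segment[OF LIMSEQ_subseq_LIMSEQ[OF s(2) \<phi>], of K]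
    by (simp add: \<psi>_def o_def)
  show False
    by (rule no_secants_near[OF good d s(1) s' b(1) rb b(3) z(1) _ X_lim y_lim, of u])
       (use u z in \<open>auto simp: W_Suc\<close>)
qed

text \<open>Since \<open>C\<close> is finite, one small \<open>s\<close> serves all of its
  elements.\<close>

lemma good_Suc:
  assumes "good t r"
  shows "\<exists>s>0. good (t(Suc r := s)) (Suc r)"
proof -
  have "\<forall>\<^sub>F s in at_right 0. \<forall>d\<in>C. rk d \<le> r \<longrightarrow> V d \<inter> W (t(Suc r := s)) (Suc r) \<subseteq> {\<lambda>c. 0}"
    using eventually_proper[OF assms] by (intro eventually_ball_finite[OF fin]) (auto simp: eventually_mono)
  moreover have "\<forall>\<^sub>F s in at_right 0. \<forall>d\<in>C. rk d = Suc r \<longrightarrow>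
     (\<forall>x\<in>V d \<inter> W (t(Suc r := s)) (Suc r). x \<noteq> (\<lambda>c. 0) \<longrightarrow>
       T d x x \<inter> W (t(Suc r := s)) (Suc r) \<subseteq> range (\<lambda>u c. u * x c) \<and> real_point x)"
    using eventually_transverse[OF assms] by (intro eventually_ball_finite[OF fin]) (auto simp: eventually_mono)
  moreover have "\<forall>\<^sub>F s in at_right 0. (s::real) > 0" by (simp add: eventually_at_right_less)
  ultimately have "\<forall>\<^sub>F s in at_right 0. s > 0 \<and> good (t(Suc r := s)) (Suc r)"
    by eventually_elim (auto simp: good_def less_Suc_eq_le)
  then show ?thesis
    using eventually_happens trivial_limit_at_right_real by blast
qed

lemma good_cong: "(\<And>i. i \<in> {1..r} \<Longrightarrow> t i = t' i) \<Longrightarrow> good t r = good t' r"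
proof -
  assume "\<And>i. i \<in> {1..r} \<Longrightarrow> t i = t' i"
  then have "W t r = W t' r" by (auto simp: W_def)
  then show ?thesis by (simp add: good_def)
qed

text \<open>Each new parameter leaves the earlier hyperplanes, and hence the earlier instances of
  \<open>good\<close>, unchanged.\<close>

theorem real_transverse_sequence: "\<exists>t. (\<forall>i. t i > 0) \<and> (\<forall>r\<le>n. good t r)"
proof (induction n)
  case 0
  show ?case by (rule exI[of _ "\<lambda>_. 1"]) (simp add: good_0)
next
  case (Suc n)
  then obtain t where t: "\<forall>i. t i > 0" "\<forall>r\<le>n. good t r" by blast
  obtain s where s: "s > 0" "good (t(Suc n := s)) (Suc n)" using good_Suc t(2) by blast
  have "good (t(Suc n := s)) r" if "r \<le> n" for r
    using t(2) that good_cong[of r t "t(Suc n := s)"] by auto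
  then show ?case using s t(1) by (intro exI[of _ "t(Suc n := s)"]) (auto simp: le_Suc_eq simp del: fun_upd_apply, simp)
qed

end

section \<open>The order on the index set\<close>

definition cnt :: "nat set \<Rightarrow> nat \<Rightarrow> nat" where
  "cnt A x = card (A \<inter> {1..x})"

text \<open>The order on \<open>Cq\<close> is the reverse pointwise order of these level functions, and the rank is,
  up to a constant, minus their sum; this turns all order computations into counting.\<close>
definition level :: "nat set \<times> nat \<Rightarrow> nat \<Rightarrow> int" where
  "level c x = int (cnt (fst c) x) - int (snd c)"

lemma subsets_pD:
  assumes "A \<in> subsets_p n p"
  shows "A \<subseteq> {1..n}" "card A = p" "finite A"
  using assms finite_subset[of A "{1..n}"] by (auto simp: subsets_p_def)

lemma cnt_le: "cnt A x \<le> x"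
  unfolding cnt_def using card_mono[of "{1..x}" "A \<inter> {1..x}"] by simp

lemma cnt_0: "cnt A 0 = 0"
  by (simp add: cnt_def)

lemma cnt_full: "A \<in> subsets_p n p \<Longrightarrow> cnt A n = p"
  using subsets_pD[of A n p] by (simp add: cnt_def Int_absorb2)

lemma cnt_Suc: "cnt A (Suc x) = cnt A x + (if Suc x \<in> A then 1 else 0)"
proof -
  have "A \<inter> {1..Suc x} = (if Suc x \<in> A then insert (Suc x) (A \<inter> {1..x}) else A \<inter> {1..x})"
    by (auto simp: le_Suc_eq)
  then show ?thesis by (simp add: cnt_def)
qed

lemma cnt_insert:
  assumes "finite A" "g \<notin> A" "g \<ge> 1"
  shows "cnt (insert g A) x = cnt A x + (if g \<le> x then 1 else 0)"
proof -
  have "insert g A \<inter> {1..x} = (if g \<le> x then insert g (A \<inter> {1..x}) else A \<inter> {1..x})"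
    using assms by auto
  then show ?thesis using assms by (simp add: cnt_def)
qed

lemma cnt_exchange:
  assumes "finite A" "a \<in> A" "g \<notin> A" "g \<ge> 1" "a \<ge> 1"
  shows "int (cnt (insert g (A - {a})) x) =
    int (cnt A x) + (if g \<le> x then 1 else 0) - (if a \<le> x then 1 else 0)"
  using cnt_insert[of "A - {a}" g x] cnt_insert[of "A - {a}" a x] assms
  by (simp add: insert_absorb)

lemma elt_bij:
  assumes "A \<in> subsets_p n p"
  shows "bij_betw (elt A) {1..p} A"
proof -
  note A = subsets_pD[OF assms]
  have "bij_betw ((!) (sorted_list_of_set A)) {..<p} A"
    using A by (intro bij_betw_nth) auto
  moreover have "bij_betw (\<lambda>i. i - 1) {1..p} {..<p}"
    by (rule bij_betw_byWitness[where f' = Suc]) auto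
  ultimately show ?thesis
    unfolding elt_def[abs_def] using bij_betw_trans by (fastforce simp: o_def)
qed

lemma elt_mono:
  assumes "A \<in> subsets_p n p" "i \<in> {1..p}" "j \<in> {1..p}"
  shows "elt A i \<le> elt A j \<longleftrightarrow> i \<le> j"
proof -
  note A = subsets_pD[OF assms(1)]
  have "sorted_wrt (<) (sorted_list_of_set A)" by simp
  then have strict: "elt A i < elt A j" if "i < j" "i \<in> {1..p}" "j \<in> {1..p}" for i j
    unfolding elt_def using that A by (intro sorted_wrt_nth_less[of "(<)"]) auto
  show ?thesis using strict[of i j] strict[of j i] assms(2,3) by (cases i j rule: linorder_cases) auto
qed

text \<open>A Galois connection: the indices \<open>j\<close> with \<open>elt A j <= x\<close> form
  an initial segment, and \<open>elt A\<close> maps it bijectively onto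
  \<open>A \<inter> {1..x}\<close>.\<close>

lemma elt_le_iff:
  assumes "A \<in> subsets_p n p" "i \<in> {1..p}"
  shows "elt A i \<le> x \<longleftrightarrow> i \<le> cnt A x"
proof -
  note A = subsets_pD[OF assms(1)]
  define J where "J = {j \<in> {1..p}. elt A j \<le> x}"
  have "bij_betw (elt A) J (A \<inter> {1..x})"
  proof (rule bij_betw_subset[OF elt_bij[OF assms(1)]])
    show "elt A ` J = A \<inter> {1..x}"
      using elt_bij[OF assms(1)] A(1) by (fastforce simp: J_def bij_betw_def)
  qed (auto simp: J_def)
  then have card: "cnt A x = card J" by (simp add: cnt_def bij_betw_same_card)
  show ?thesis
  proof
    assume le: "elt A i \<le> x"
    have "{1..i} \<subseteq> J"
    proof
      fix j assume j: "j \<in> {1..i}"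
      then have "elt A j \<le> elt A i" using elt_mono[OF assms(1), of j i] assms(2) by auto
      then show "j \<in> J" using le j assms(2) by (auto simp: J_def)
    qed
    then show "i \<le> cnt A x" using card_mono[of J "{1..i}"] card by (simp add: J_def)
  next
    assume le: "i \<le> cnt A x"
    show "elt A i \<le> x"
    proof (rule ccontr)
      assume n: "\<not> elt A i \<le> x"
      have "J \<subseteq> {1..<i}"
      proof
        fix j assume j: "j \<in> J"
        then have "\<not> elt A i \<le> elt A j" using n by (auto simp: J_def)
        then have "\<not> i \<le> j" using elt_mono[OF assms(1), of i j] assms(2) j by (auto simp: J_def)
        then show "j \<in> {1..<i}" using j by (auto simp: J_def)
      qed
      then have "card J \<le> i - 1" using card_mono[of "{1..<i}" J] by simp
      moreover have "1 \<le> i" using assms(2) by simp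
      ultimately show False using le card by linarith
    qed
  qed
qed

text \<open>By \<open>elt_le_iff\<close>, the shifted comparison of entries amounts to
  \<open>cnt B x - (b - a) <= cnt A x\<close> for all \<open>x\<close>.\<close>

lemma leC_iff_level:
  assumes "A \<in> subsets_p n p" "B \<in> subsets_p n p"
  shows "leC p (A, a) (B, b) \<longleftrightarrow> (\<forall>x\<le>n. level (B, b) x \<le> level (A, a) x)"
proof
  assume le: "leC p (A, a) (B, b)"
  then have ab: "a \<le> b" by (simp add: leC_def)
  show "\<forall>x\<le>n. level (B, b) x \<le> level (A, a) x"
  proof (intro allI impI)
    fix x
    have p: "cnt B x \<le> p"
      using subsets_pD[OF assms(2)] card_mono[of B "B \<inter> {1..x}"] by (simp add: cnt_def)
    show "level (B, b) x \<le> level (A, a) x"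
    proof (cases "cnt B x \<le> b - a")
      case True
      then show ?thesis using ab by (simp add: level_def)
    next
      case False
      define i where "i = cnt B x - (b - a)"
      have i: "i \<in> {1..p - (b - a)}" "b - a + i = cnt B x" "b - a < p" using False p by (auto simp: i_def)
      have "elt B (b - a + i) \<le> x" using elt_le_iff[OF assms(2), of "cnt B x" x] i p by auto
      moreover have "\<forall>i\<in>{1..p - (b - a)}. elt A i \<le> elt B (b - a + i)"
        using le i(3) unfolding leC_def fst_conv snd_conv by blast
      then have "elt A i \<le> elt B (b - a + i)" using i(1) by blast
      ultimately have "elt A i \<le> x" by simp
      then have "i \<le> cnt A x" using elt_le_iff[OF assms(1), of i x] i by auto
      then show ?thesis using i ab by (simp add: level_def)
    qed
  qed
next
  assume lev: "\<forall>x\<le>n. level (B, b) x \<le> level (A, a) x"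
  \<comment> \<open>At \<open>x = 0\<close> the counts vanish and only the exponents remain.\<close>
  then have ab: "a \<le> b" by (auto simp: level_def cnt_0 dest: spec[of _ 0])
  have "elt A i \<le> elt B (b - a + i)" if "b - a < p" "i \<in> {1..p - (b - a)}" for i
  proof -
    have j: "b - a + i \<in> {1..p}" using that by auto
    then have "elt B (b - a + i) \<in> B" using elt_bij[OF assms(2)] by (auto simp: bij_betw_def)
    then have "elt B (b - a + i) \<le> n" using subsets_pD[OF assms(2)] by auto
    moreover have "b - a + i \<le> cnt B (elt B (b - a + i))" using elt_le_iff[OF assms(2) j] by blast
    ultimately have "i \<le> cnt A (elt B (b - a + i))" using lev ab by (force simp: level_def)
    then show ?thesis using elt_le_iff[OF assms(1), of i] that by auto
  qed
  then show "leC p (A, a) (B, b)" using ab by (simp add: leC_def)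
qed

lemma leC_level:
  assumes "c \<in> Cq m p q" "d \<in> Cq m p q"
  shows "leC p c d \<longleftrightarrow> (\<forall>x\<le>m + p. level d x \<le> level c x)"
  using assms leC_iff_level[of "fst c" "m + p" p "fst d" "snd c" "snd d"] by (auto simp: Cq_def)

text \<open>The value at 0 gives the exponent; the increments then decide membership in the
  set.\<close>

lemma level_inject:
  assumes c: "c \<in> Cq m p q" "d \<in> Cq m p q" and eq: "\<forall>x\<le>m + p. level c x = level d x"
  shows "c = d"
proof -
  have snd: "snd c = snd d" using spec[OF eq, of 0] by (simp add: level_def cnt_0)
  then have cnt: "cnt (fst c) x = cnt (fst d) x" if "x \<le> m + p" for x
    using eq that by (simp add: level_def)
  have mem_Suc: "Suc y \<in> fst c \<longleftrightarrow> Suc y \<in> fst d" if "Suc y \<le> m + p" for y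
    using cnt[OF that] cnt[of y] that unfolding cnt_Suc by (simp split: if_splits)
  have "x \<in> fst c \<longleftrightarrow> x \<in> fst d" if "x \<in> {1..m + p}" for x
    using mem_Suc[of "x - 1"] that by simp
  moreover have "fst c \<subseteq> {1..m + p}" "fst d \<subseteq> {1..m + p}"
    using c by (auto simp: Cq_def subsets_p_def)
  ultimately have "fst c = fst d" by blast
  then show ?thesis using snd by (simp add: prod_eq_iff)
qed

lemma elt_ge: "A \<in> subsets_p n p \<Longrightarrow> i \<in> {1..p} \<Longrightarrow> i \<le> elt A i"
  using elt_le_iff[of A n p i "elt A i"] cnt_le[of A "elt A i"] by simp

text \<open>Double counting: each \<open>a\<close> in \<open>A\<close> is counted for the
  \<open>n - a\<close> values \<open>x\<close> with \<open>a <= x < n\<close>.\<close>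

lemma sum_cnt:
  assumes "A \<in> subsets_p n p"
  shows "(\<Sum>x<n. cnt A x) + \<Sum>A = n * p"
proof -
  note A = subsets_pD[OF assms]
  have "cnt A x = (\<Sum>a\<in>A. if a \<le> x then 1 else 0)" for x
  proof -
    have "A \<inter> {1..x} = {a \<in> A. a \<le> x}" using A by auto
    then show ?thesis using A(3) by (simp add: cnt_def sum.If_cases Int_def)
  qed
  then have "(\<Sum>x<n. cnt A x) = (\<Sum>a\<in>A. \<Sum>x<n. if a \<le> x then 1 else 0)"
    by (simp add: sum.swap[of _ A])
  also have "\<dots> = (\<Sum>a\<in>A. n - a)"
  proof (rule sum.cong[OF refl])
    fix a
    have "{..<n} \<inter> {x. a \<le> x} = {a..<n}" by auto
    then show "(\<Sum>x<n. if a \<le> x then 1 else 0) = n - a" by (simp add: sum.If_cases)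
  qed
  finally have "(\<Sum>x<n. cnt A x) + \<Sum>A = (\<Sum>a\<in>A. (n - a) + a)" by (simp add: sum.distrib)
  also have "\<dots> = (\<Sum>a\<in>A. n)" using A by (intro sum.cong) auto
  finally show ?thesis using A by simp
qed

lemma rank_level:
  assumes "c \<in> Cq m p q"
  shows "int (rank_C m p c) + (\<Sum>x<m + p. level c x) = int ((m + p) * p) - int (\<Sum>{1..p})"
proof -
  have A: "fst c \<in> subsets_p (m + p) p" using assms by (auto simp: Cq_def)
  have "absa p (fst c) + \<Sum>{1..p} = (\<Sum>i=1..p. (elt (fst c) i - i) + i)"
    by (simp add: absa_def sum.distrib)
  \<comment> \<open>By \<open>elt_ge\<close> the truncated subtraction in \<open>absa\<close> is
    exact.\<close>
  also have "\<dots> = (\<Sum>i=1..p. elt (fst c) i)"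
    using elt_ge[OF A] by (intro sum.cong) auto
  also have "\<dots> = \<Sum>(fst c)" using sum.reindex_bij_betw[OF elt_bij[OF A], of "\<lambda>x. x"] by simp
  finally have "absa p (fst c) + \<Sum>{1..p} + (\<Sum>x<m + p. cnt (fst c) x) = (m + p) * p"
    using sum_cnt[OF A] by simp
  then have "int (absa p (fst c)) + int (\<Sum>{1..p}) + (\<Sum>x<m + p. int (cnt (fst c) x)) = int ((m + p) * p)"
    by (metis of_nat_add of_nat_sum)
  then show ?thesis by (simp add: rank_C_def level_def sum_subtractf algebra_simps)
qed

lemma rank_strict_mono:
  assumes "c \<in> Cq m p q" "d \<in> Cq m p q" "leC p c d" "c \<noteq> d" "0 < m + p"
  shows "rank_C m p c < rank_C m p d"
proof -
  have le: "\<forall>x\<le>m + p. level d x \<le> level c x" using assms leC_level by blast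
  obtain x where x: "x \<le> m + p" "level d x \<noteq> level c x"
    using level_inject[OF assms(1,2)] assms(4) by metis
  \<comment> \<open>The rank formula sums only over \<open>x < m + p\<close>. A difference found at
    the right end also occurs at 0, since the two end levels always differ by
    \<open>p\<close>.\<close>
  have end_shift: "level e (m + p) = level e 0 + int p" if "e \<in> Cq m p q" for e
    using that cnt_full[of "fst e" "m + p" p] by (auto simp: level_def cnt_0 Cq_def)
  have "\<exists>x<m + p. level d x < level c x"
  proof (cases "x = m + p")
    case True
    then have "level d 0 < level c 0"
      using end_shift[OF assms(1)] end_shift[OF assms(2)] x le by force
    then show ?thesis using assms(5) by blast
  next
    case False
    then show ?thesis using x le by (intro exI[of _ x]) (auto simp: order_less_le)
  qed
  then have "(\<Sum>x<m + p. level d x) < (\<Sum>x<m + p. level c x)"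
    using le by (intro sum_strict_mono_ex1) auto
  then show ?thesis using rank_level[OF assms(1)] rank_level[OF assms(2)] by linarith
qed

text \<open>At most \<open>p - i\<close> elements of the set exceed \<open>m + i\<close>, so its
  \<open>i\<close>-th entry is at most \<open>m + i\<close>.\<close>

lemma rank_le_Nbig:
  assumes "c \<in> Cq m p q"
  shows "rank_C m p c \<le> Nbig m p q"
proof -
  have A: "fst c \<in> subsets_p (m + p) p" and a: "snd c \<le> q" using assms by (auto simp: Cq_def)
  have "elt (fst c) i - i \<le> m" if i: "i \<in> {1..p}" for i
  proof -
    have sub: "fst c \<subseteq> (fst c \<inter> {1..m + i}) \<union> {m + i<..m + p}" using subsets_pD[OF A] by auto
    then have "p \<le> card ((fst c \<inter> {1..m + i}) \<union> {m + i<..m + p})"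
      using card_mono[OF _ sub] subsets_pD[OF A] by simp
    also have "\<dots> \<le> cnt (fst c) (m + i) + (p - i)"
      unfolding cnt_def by (rule order_trans[OF card_Un_le]) auto
    finally have "i \<le> cnt (fst c) (m + i)" using i by auto
    then show ?thesis using elt_le_iff[OF A i, of "m + i"] by simp
  qed
  then have "absa p (fst c) \<le> (\<Sum>i=1..p. m)" unfolding absa_def by (rule sum_mono)
  then have "absa p (fst c) \<le> p * m" by simp
  moreover have "snd c * (m + p) \<le> q * (m + p)" using a by (rule mult_right_mono) simp
  ultimately show ?thesis unfolding rank_C_def Nbig_def by linarith
qed

text \<open>An exchange changes each count by at most one. If one exponent grows, this outweighs the
  change; if both stay fixed, the set that trades its element for a larger one moves up.\<close>

lemma exchange_goes_up:
  assumes c: "(A, a) \<in> Cq m p q" "(B, b) \<in> Cq m p q" and g: "g \<in> B - A" "h \<in> A - B"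
    and ij: "i + j = a + b"
    and ex: "(insert g (A - {h}), i) \<in> Cq m p q" "(insert h (B - {g}), j) \<in> Cq m p q"
  shows "leC p (A, a) (insert g (A - {h}), i) \<or> leC p (B, b) (insert h (B - {g}), j)"
proof -
  have AB: "A \<in> subsets_p (m + p) p" "B \<in> subsets_p (m + p) p" using c by (auto simp: Cq_def)
  have gh: "g \<ge> 1" "h \<ge> 1" "finite A" "finite B" "g \<noteq> h"
    using subsets_pD[OF AB(1)] subsets_pD[OF AB(2)] g by auto
  have A: "int (cnt (insert g (A - {h})) x) =
      int (cnt A x) + (if g \<le> x then 1 else 0) - (if h \<le> x then 1 else 0)" for x
    using gh g by (intro cnt_exchange) auto
  have B: "int (cnt (insert h (B - {g})) x) =
      int (cnt B x) + (if h \<le> x then 1 else 0) - (if g \<le> x then 1 else 0)" for x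
    using gh g by (intro cnt_exchange) auto
  consider "i > a" | "j > b" | "i = a" "j = b" using ij by linarith
  then show ?thesis
  proof cases
    case 1
    then have "leC p (A, a) (insert g (A - {h}), i)"
      unfolding leC_level[OF c(1) ex(1)] by (simp add: level_def A)
    then show ?thesis ..
  next
    case 2
    then have "leC p (B, b) (insert h (B - {g}), j)"
      unfolding leC_level[OF c(2) ex(2)] by (simp add: level_def B)
    then show ?thesis ..
  next
    case 3
    show ?thesis
    proof (cases "h < g")
      case True
      with 3 have "leC p (A, a) (insert g (A - {h}), i)"
        unfolding leC_level[OF c(1) ex(1)] by (simp add: level_def A)
      then show ?thesis ..
    next
      case False
      with 3 gh have "leC p (B, b) (insert h (B - {g}), j)"
        unfolding leC_level[OF c(2) ex(2)] by (simp add: level_def B)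
      then show ?thesis ..
    qed
  qed
qed

lemma leC_same_set: "(A, i) \<in> Cq m p q \<Longrightarrow> (A, j) \<in> Cq m p q \<Longrightarrow> i \<le> j \<Longrightarrow> leC p (A, i) (A, j)"
  by (subst leC_level) (auto simp: level_def)

section \<open>Exchange relations among minors\<close>

text \<open>Columns are chosen by an arbitrary function, so column replacement may produce repeated
  or unsorted columns. Rows of \<open>M\<close> count from 1, positions in \<open>f\<close> from
  0.\<close>

definition cdet :: "nat \<Rightarrow> (nat \<Rightarrow> nat \<Rightarrow> complex) \<Rightarrow> (nat \<Rightarrow> nat) \<Rightarrow> complex" where
  "cdet r M f = Determinant.det (Matrix.mat r r (\<lambda>(i, j). M (Suc i) (f j)))"

lemma cdet_altdef:
  "cdet r M f = (\<Sum>\<pi> | \<pi> permutes {0..<r}. of_int (sign \<pi>) * (\<Prod>i<r. M (Suc i) (f (\<pi> i))))"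
proof -
  let ?A = "Matrix.mat r r (\<lambda>(i, j). M (Suc i) (f j))"
  have "cdet r M f = (\<Sum>\<pi> | \<pi> permutes {0..<r}. of_int (sign \<pi>) * (\<Prod>i = 0..<r. ?A $$ (i, \<pi> i)))"
    unfolding cdet_def by (rule det_def') simp
  also have "\<dots> = (\<Sum>\<pi> | \<pi> permutes {0..<r}. of_int (sign \<pi>) * (\<Prod>i<r. M (Suc i) (f (\<pi> i))))"
  proof (rule sum.cong[OF refl])
    fix \<pi> assume "\<pi> \<in> {\<pi>. \<pi> permutes {0..<r}}"
    then have "\<pi> i < r" if "i < r" for i using permutes_in_image[of \<pi> "{0..<r}" i] that by simp
    then have "(\<Prod>i = 0..<r. ?A $$ (i, \<pi> i)) = (\<Prod>i<r. M (Suc i) (f (\<pi> i)))"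
      by (intro prod.cong) auto
    then show "of_int (sign \<pi>) * (\<Prod>i = 0..<r. ?A $$ (i, \<pi> i)) =
      of_int (sign \<pi>) * (\<Prod>i<r. M (Suc i) (f (\<pi> i)))" by simp
  qed
  finally show ?thesis .
qed

text \<open>Conjugation by \<open>Suc\<close> carries permutations of \<open>{0..<r}\<close> to
  those of \<open>{1..r}\<close> and preserves signs.\<close>

lemma minor_eq_cdet: "minor r M A = cdet r M ((!) (sorted_list_of_set A))"
proof -
  have bij: "bij_betw Suc {0..<r} {1..r}" by (auto simp: bij_betw_def image_Suc_atLeastLessThan)
  have bij': "bij_betw (map_permutation {0..<r} Suc) {\<pi>. \<pi> permutes {0..<r}} {\<pi>. \<pi> permutes {1..r}}"
    using bij_betw_permutations[OF bij]
    by (simp add: map_permutation_def[abs_def] restrict_id_def[abs_def] bij_betw_imp_surj_on[OF bij] o_def less_Suc_eq_le)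
  have "minor r M A = (\<Sum>\<pi> | \<pi> permutes {0..<r}. of_int (sign (map_permutation {0..<r} Suc \<pi>)) *
      (\<Prod>i=1..r. M i (elt A (map_permutation {0..<r} Suc \<pi> i))))"
    unfolding minor_def by (rule sum.reindex_bij_betw[symmetric, OF bij'])
  also have "\<dots> = cdet r M ((!) (sorted_list_of_set A))"
    unfolding cdet_altdef
  proof (rule sum.cong)
    fix \<pi> assume "\<pi> \<in> {\<pi>. \<pi> permutes {0..<r}}"
    then have \<pi>: "\<pi> permutes {0..<r}" by simp
    have "(\<Prod>i=1..r. M i (elt A (map_permutation {0..<r} Suc \<pi> i))) =
        (\<Prod>i<r. M (Suc i) (sorted_list_of_set A ! \<pi> i))"
      unfolding One_nat_def prod.atLeast1_atMost_eq by (intro prod.cong) (auto simp: map_permutation_apply elt_def)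
    then show "of_int (sign (map_permutation {0..<r} Suc \<pi>)) *
      (\<Prod>i=1..r. M i (elt A (map_permutation {0..<r} Suc \<pi> i))) =
      of_int (sign \<pi>) * (\<Prod>i<r. M (Suc i) (sorted_list_of_set A ! \<pi> i))"
      using sign_map_permutation[of Suc "{0..<r}" \<pi>] \<pi> by simp
  qed simp
  finally show ?thesis .
qed

text \<open>Cofactors along column \<open>k\<close> ignore that column, so those of the original
  matrix serve for every replacement \<open>y\<close>.\<close>

lemma cdet_expand_column:
  assumes "k < r"
  shows "cdet r M (f(k := y)) =
    (\<Sum>i<r. M (Suc i) y * cofactor (Matrix.mat r r (\<lambda>(i, j). M (Suc i) (f j))) i k)"
proof -
  let ?A = "\<lambda>f. Matrix.mat r r (\<lambda>(i, j). M (Suc i) (f j))"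
  have "cofactor (?A (f(k := y))) i k = cofactor (?A f) i k" if "i < r" for i
  proof -
    have "mat_delete (?A (f(k := y))) i k = mat_delete (?A f) i k"
      using assms that by (intro eq_matI) (auto simp: mat_delete_def)
    then show ?thesis by (simp add: cofactor_def)
  qed
  then show ?thesis using assms
    unfolding cdet_def by (subst laplace_expansion_column[of _ r k]) (auto intro!: sum.cong)
qed

text \<open>Cramer's rule, read off from the product of a matrix with its adjugate.\<close>

lemma cdet_cramer:
  assumes "i < r"
  shows "cdet r M f * M (Suc i) y = (\<Sum>j<r. cdet r M (f(j := y)) * M (Suc i) (f j))"
proof -
  define A where "A = Matrix.mat r r (\<lambda>(i, j). M (Suc i) (f j))"
  have A: "A \<in> carrier_mat r r" by (simp add: A_def)
  have adj: "(\<Sum>j<r. M (Suc i) (f j) * cofactor A k j) = (if i = k then cdet r M f else 0)"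
    if "k < r" for k
  proof -
    have "(A * adj_mat A) $$ (i, k) = (\<Sum>j<r. M (Suc i) (f j) * cofactor A k j)"
      using assms that adj_mat(1)[OF A]
      by (auto simp: scalar_prod_def adj_mat_def A_def lessThan_atLeast0 intro!: sum.cong)
    then show ?thesis
      using assms that unfolding adj_mat(2)[OF A] by (auto simp: cdet_def A_def)
  qed
  have "(\<Sum>j<r. cdet r M (f(j := y)) * M (Suc i) (f j))
      = (\<Sum>j<r. \<Sum>k<r. M (Suc k) y * cofactor A k j * M (Suc i) (f j))"
    by (intro sum.cong refl) (simp add: cdet_expand_column A_def sum_distrib_right)
  also have "\<dots> = (\<Sum>k<r. M (Suc k) y * (\<Sum>j<r. M (Suc i) (f j) * cofactor A k j))"
    by (subst sum.swap) (simp add: sum_distrib_left mult_ac)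
  also have "\<dots> = (\<Sum>k<r. if i = k then M (Suc k) y * cdet r M f else 0)"
    by (intro sum.cong refl) (simp add: adj)
  finally show ?thesis using assms by (simp add: mult.commute)
qed

text \<open>Expand the second determinant along column \<open>k\<close>, rewrite the first
  determinant times that column by Cramer's rule, and fold the expansion back.\<close>

lemma cdet_exchange:
  assumes "k < r"
  shows "cdet r M f * cdet r M h = (\<Sum>j<r. cdet r M (f(j := h k)) * cdet r M (h(k := f j)))"
proof -
  define c where "c i = cofactor (Matrix.mat r r (\<lambda>(i, j). M (Suc i) (h j))) i k" for i
  have c: "cdet r M (h(k := y)) = (\<Sum>i<r. M (Suc i) y * c i)" for y
    unfolding c_def by (rule cdet_expand_column[OF assms])
  have "cdet r M f * cdet r M h = cdet r M f * cdet r M (h(k := h k))" by simp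
  also have "\<dots> = (\<Sum>i<r. (cdet r M f * M (Suc i) (h k)) * c i)"
    unfolding c by (simp add: sum_distrib_left mult.assoc)
  also have "\<dots> = (\<Sum>i<r. \<Sum>j<r. cdet r M (f(j := h k)) * M (Suc i) (f j) * c i)"
    by (intro sum.cong refl) (simp add: cdet_cramer[of _ r M f "h k"] sum_distrib_right)
  also have "\<dots> = (\<Sum>j<r. cdet r M (f(j := h k)) * cdet r M (h(k := f j)))"
    unfolding c by (subst sum.swap) (simp add: sum_distrib_left mult.assoc)
  finally show ?thesis .
qed

lemma cdet_not_inj:
  assumes "i < r" "j < r" "i \<noteq> j" "f i = f j"
  shows "cdet r M f = 0"
  unfolding cdet_def using assms
  by (intro Determinant.det_identical_columns[of _ r i j]) auto

text \<open>The factor is the sign of the permutation sorting the columns; it must not depend on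
  \<open>M\<close>, so that exchange relations have constant coefficients.\<close>

lemma cdet_inj:
  assumes "inj_on f {..<r}"
  shows "\<exists>\<sigma>::real. \<forall>M. cdet r M f = of_real \<sigma> * minor r M (f ` {..<r})"
proof -
  define A where "A = f ` {..<r}"
  define s where "s = (!) (sorted_list_of_set A)"
  have card: "card A = r" "finite A" using assms by (simp_all add: A_def card_image)
  have "bij_betw s {..<length (sorted_list_of_set A)} (set (sorted_list_of_set A))"
    unfolding s_def by (rule bij_betw_nth) auto
  then have s: "bij_betw s {..<r} A" using card by simp
  define \<pi> where "\<pi> j = (if j < r then inv_into {..<r} s (f j) else j)" for j
  have "bij_betw (inv_into {..<r} s \<circ> f) {..<r} {..<r}"
    using bij_betw_trans[OF _ bij_betw_inv_into[OF s]] assms by (auto simp: bij_betw_def A_def)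
  then have "bij_betw \<pi> {..<r} {..<r}"
    by (subst bij_betw_cong[of _ _ "inv_into {..<r} s \<circ> f"]) (auto simp: \<pi>_def)
  then have \<pi>: "\<pi> permutes {0..<r}"
    by (intro bij_imp_permutes) (auto simp: \<pi>_def lessThan_atLeast0)
  have f: "f j = s (\<pi> j)" if "j < r" for j
    using that s by (simp add: \<pi>_def A_def bij_betw_def f_inv_into_f)
  have "cdet r M f = of_int (sign \<pi>) * minor r M A" for M
  proof -
    \<comment> \<open>Transposed, because the permutation lemma for determinants acts on
      rows.\<close>
    let ?B = "Matrix.mat r r (\<lambda>(i, j). M (Suc j) (s i))"
    have "cdet r M f = Determinant.det (transpose_mat (Matrix.mat r r (\<lambda>(i, j). M (Suc i) (f j))))"
      unfolding cdet_def by (rule Determinant.det_transpose[symmetric, of _ r]) simp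
    also have "transpose_mat (Matrix.mat r r (\<lambda>(i, j). M (Suc i) (f j))) =
        Matrix.mat r r (\<lambda>(i, j). ?B $$ (\<pi> i, j))"
      using permutes_in_image[OF \<pi>] by (intro eq_matI) (auto simp: f)
    also have "Determinant.det \<dots> = of_int (sign \<pi>) * Determinant.det ?B"
      by (subst det_permute_rows[of _ r]) (use \<pi> in auto)
    also have "?B = transpose_mat (Matrix.mat r r (\<lambda>(i, j). M (Suc i) (s j)))"
      by (intro eq_matI) auto
    also have "Determinant.det \<dots> = minor r M A"
      unfolding minor_eq_cdet cdet_def s_def by (rule Determinant.det_transpose[of _ r]) simp
    finally show ?thesis .
  qed
  then show ?thesis unfolding A_def by (intro exI[of _ "of_int (sign \<pi>)"]) simp
qed

lemma image_update:
  "inj_on f S \<Longrightarrow> j \<in> S \<Longrightarrow> (f(j := y)) ` S = insert y (f ` S - {f j})"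
  by (auto simp: inj_on_def)

lemma inj_on_update: "inj_on f S \<Longrightarrow> y \<notin> f ` S \<Longrightarrow> inj_on (f(j := y)) S"
  by (auto simp: inj_on_def)

text \<open>The column exchange \<open>cdet_exchange\<close> with sorted columns, the sorting signs
  being absorbed into \<open>\<sigma>\<close>.\<close>

lemma minor_exchange:
  assumes A: "finite A" "card A = r" and B: "finite B" "card B = r" and g: "g \<in> B - A"
  shows "\<exists>\<sigma>::nat \<Rightarrow> real. \<forall>M. minor r M A * minor r M B =
    (\<Sum>a\<in>A - B. of_real (\<sigma> a) * (minor r M (insert g (A - {a})) * minor r M (insert a (B - {g}))))"
proof -
  define f where "f = (!) (sorted_list_of_set A)"
  define h where "h = (!) (sorted_list_of_set B)"
  have f: "bij_betw f {..<r} A" and h: "bij_betw h {..<r} B"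
    using bij_betw_nth[of "sorted_list_of_set A" "{..<r}" A] bij_betw_nth[of "sorted_list_of_set B" "{..<r}" B]
      A B by (simp_all add: f_def h_def)
  obtain k where k: "k < r" "h k = g" using h g by (force simp: bij_betw_def)
  have exch: "\<exists>\<sigma>::real. \<forall>M. cdet r M (f(j := g)) * cdet r M (h(k := f j)) =
     of_real \<sigma> * (minor r M (insert g (A - {f j})) * minor r M (insert (f j) (B - {g})))"
    if j: "j < r" "f j \<notin> B" for j
  proof -
    have "inj_on (f(j := g)) {..<r}" "(f(j := g)) ` {..<r} = insert g (A - {f j})"
      using f g j image_update[of f "{..<r}" j g] inj_on_update[of f "{..<r}" g j]
      by (simp_all add: bij_betw_def)
    moreover have "inj_on (h(k := f j)) {..<r}" "(h(k := f j)) ` {..<r} = insert (f j) (B - {g})"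
      using h k j image_update[of h "{..<r}" k "f j"] inj_on_update[of h "{..<r}" "f j" k]
      by (simp_all add: bij_betw_def)
    ultimately obtain \<sigma> \<tau> :: real where
      "\<And>M. cdet r M (f(j := g)) = of_real \<sigma> * minor r M (insert g (A - {f j}))"
      "\<And>M. cdet r M (h(k := f j)) = of_real \<tau> * minor r M (insert (f j) (B - {g}))"
      using cdet_inj by metis
    then show ?thesis by (intro exI[of _ "\<sigma> * \<tau>"]) simp
  qed
  define ix where "ix = inv_into {..<r} f"
  have ix: "bij_betw ix A {..<r}" "\<And>a. a \<in> A \<Longrightarrow> f (ix a) = a" "\<And>a. a \<in> A \<Longrightarrow> ix a < r"
    using f bij_betw_inv_into[OF f] by (auto simp: ix_def bij_betw_def f_inv_into_f)
  have "\<forall>a\<in>A - B. \<exists>\<sigma>::real. \<forall>M. cdet r M (f(ix a := g)) * cdet r M (h(k := a)) =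
     of_real \<sigma> * (minor r M (insert g (A - {a})) * minor r M (insert a (B - {g})))"
    using exch[of "ix _"] ix by (metis DiffD1 DiffD2)
  then obtain \<sigma> :: "nat \<Rightarrow> real" where \<sigma>: "\<And>a M. a \<in> A - B \<Longrightarrow>
     cdet r M (f(ix a := g)) * cdet r M (h(k := a)) =
     of_real (\<sigma> a) * (minor r M (insert g (A - {a})) * minor r M (insert a (B - {g})))"
    by metis
  have "minor r M A * minor r M B =
    (\<Sum>a\<in>A - B. of_real (\<sigma> a) * (minor r M (insert g (A - {a})) * minor r M (insert a (B - {g}))))" for M
  proof -
    \<comment> \<open>Moving a common element into \<open>B\<close> repeats a column, as it already
      stands at a position other than \<open>k\<close>.\<close>
    have zero: "cdet r M (h(k := a)) = 0" if a: "a \<in> A \<inter> B" for a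
    proof -
      obtain i where i: "i < r" "h i = a" using h a by (force simp: bij_betw_def)
      then have "i \<noteq> k" using a g k by auto
      then show ?thesis using i k by (intro cdet_not_inj[of i r k]) auto
    qed
    have "minor r M A * minor r M B = (\<Sum>j<r. cdet r M (f(j := g)) * cdet r M (h(k := f j)))"
      unfolding minor_eq_cdet f_def[symmetric] h_def[symmetric] k(2)[symmetric]
      by (rule cdet_exchange[OF k(1)])
    also have "\<dots> = (\<Sum>a\<in>A. cdet r M (f(ix a := g)) * cdet r M (h(k := f (ix a))))"
      by (rule sum.reindex_bij_betw[symmetric, OF ix(1)])
    also have "\<dots> = (\<Sum>a\<in>A - B. cdet r M (f(ix a := g)) * cdet r M (h(k := a)))"
      using A zero by (intro sum.mono_neutral_cong_right) (auto simp: ix)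
    finally show ?thesis by (simp add: \<sigma>)
  qed
  then show ?thesis by blast
qed

section \<open>Falling factorials \<open>ffall\<close> and the nonvanishing of the coefficients of
  the hyperplanes\<close>

definition ffall :: "nat \<Rightarrow> complex \<Rightarrow> complex" where
  "ffall k x = (\<Prod>l<k. x - of_nat l)"

lemma higher_deriv_power:
  "(deriv ^^ k) (\<lambda>\<tau>. \<tau> ^ n) = (\<lambda>\<tau>::complex. ffall k (of_nat n) * \<tau> ^ (n - k))"
proof (induction k)
  case (Suc k)
  have "deriv (\<lambda>\<tau>. ffall k (of_nat n) * \<tau> ^ (n - k)) \<tau> = ffall (Suc k) (of_nat n) * \<tau> ^ (n - Suc k)"
    for \<tau> :: complex
  proof (rule DERIV_imp_deriv)
    have "((\<lambda>\<tau>. ffall k (of_nat n) * \<tau> ^ (n - k)) has_field_derivative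
       ffall k (of_nat n) * (of_nat (n - k) * \<tau> ^ (n - k - 1))) (at \<tau>)"
      by (auto intro!: derivative_eq_intros)
    \<comment> \<open>For \<open>k > n\<close> the difference \<open>n - k\<close> is truncated, but
      the falling factorial then already contains the factor 0.\<close>
    moreover have "ffall k (of_nat n) * of_nat (n - k) = ffall (Suc k) (of_nat n)"
    proof (cases "k \<le> n")
      case True
      then show ?thesis by (simp add: ffall_def of_nat_diff)
    next
      case False
      then have "ffall k (of_nat n) = 0" by (auto simp: ffall_def)
      then show ?thesis by (simp add: ffall_def)
    qed
    ultimately show "((\<lambda>\<tau>. ffall k (of_nat n) * \<tau> ^ (n - k)) has_field_derivative
       ffall (Suc k) (of_nat n) * \<tau> ^ (n - Suc k)) (at \<tau>)"
      by (simp flip: mult.assoc)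
  qed
  then show ?case using Suc by auto
qed (simp add: ffall_def)

lemma Lmat_1: "Lmat m n 1 1 i j = ffall (i - 1) (of_nat (j - 1))"
  by (simp add: Lmat_def higher_deriv_power)

lemma ffall_eq_0: "x < k \<Longrightarrow> ffall k (of_nat x) = 0"
  by (auto simp: ffall_def)

text \<open>The combination is a polynomial of degree below \<open>m\<close> with \<open>m\<close>
  roots, hence zero. Its values at 0, 1, 2, ... form a triangular system for the
  \<open>v i\<close>.\<close>

lemma ffall_combination_zero:
  assumes "finite X" "card X = m" "\<And>x. x \<in> X \<Longrightarrow> (\<Sum>i<m. v i * ffall i x) = 0" "i < m"
  shows "v i = 0"
proof -
  define P where "P = (\<Sum>i<m. Polynomial.smult (v i) (\<Prod>l<i. [:- of_nat l, 1:]))"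
  have poly: "poly P x = (\<Sum>i<m. v i * ffall i x)" for x
    by (simp add: P_def poly_sum poly_prod ffall_def)
  have "P = 0"
  proof (rule ccontr)
    assume "P \<noteq> 0"
    then have "card {x. poly P x = 0} \<le> degree P" "finite {x. poly P x = 0}"
      by (auto simp: card_poly_roots_bound poly_roots_finite)
    moreover have "X \<subseteq> {x. poly P x = 0}" using assms(3) poly by auto
    ultimately have "m \<le> degree P" using assms(2) card_mono[of "{x. poly P x = 0}" X] by simp
    moreover have "degree P \<le> m - 1" unfolding P_def
    proof (rule degree_sum_le)
      fix i assume "i \<in> {..<m}"
      then show "degree (Polynomial.smult (v i) (\<Prod>l<i. [:- of_nat l, 1:])) \<le> m - 1"
        by (intro order_trans[OF degree_smult_le])
           (use degree_prod_sum_le[of "{..<i}" "\<lambda>l. [:- complex_of_nat l, 1:]"] in auto)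
    qed simp
    ultimately show False using assms(4) by simp
  qed
  then have 0: "(\<Sum>i<m. v i * ffall i (of_nat k)) = 0" for k using poly[of "of_nat k"] by simp
  show ?thesis using assms(4)
  proof (induction i rule: less_induct)
    case (less i)
    \<comment> \<open>Later terms vanish because \<open>i\<close> is a root of
      \<open>ffall j\<close>, earlier ones by the induction hypothesis.\<close>
    have "(\<Sum>j<m. v j * ffall j (of_nat i)) = (\<Sum>j<m. if j = i then v i * ffall i (of_nat i) else 0)"
      using less ffall_eq_0 by (intro sum.cong refl) (auto, metis linorder_neqE_nat)
    then have "v i * ffall i (of_nat i) = 0" using 0[of i] less.prems by simp
    moreover have "ffall i (of_nat i) \<noteq> 0" by (auto simp: ffall_def)
    ultimately show ?case by simp
  qed
qed

text \<open>At \<open>s = t = 1\<close> the entries are falling factorials. A singular minor would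
  give a nontrivial combination of them vanishing at the \<open>m\<close> distinct points
  \<open>s j - 1\<close>.\<close>

lemma lcoef_real_nonzero:
  assumes "card ({1..m + p} - A) = m"
  shows "lcoef m p A \<in> \<real>" "lcoef m p A \<noteq> 0"
proof -
  define S where "S = {1..m + p} - A"
  define s where "s = (!) (sorted_list_of_set S)"
  have s: "bij_betw s {..<m} S"
    using bij_betw_nth[of "sorted_list_of_set S" "{..<m}" S] assms by (simp add: s_def S_def)
  have "ffall k (of_nat x) \<in> \<real>" for k x by (simp add: ffall_def prod_in_Reals)
  then show "lcoef m p A \<in> \<real>"
    unfolding lcoef_def minor_def Lmat_1 by (intro Reals_mult Reals_power sum_in_Reals prod_in_Reals) auto
  define D where "D = Matrix.mat m m (\<lambda>(i, j). ffall i (of_nat (s j - 1)))"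
  have D: "D \<in> carrier_mat m m" by (simp add: D_def)
  have "Determinant.det D \<noteq> 0"
  proof
    assume "Determinant.det D = 0"
    \<comment> \<open>The transpose is used to obtain a relation among rows, that is, among the
      functions \<open>ffall i\<close>.\<close>
    then have "Determinant.det (transpose_mat D) = 0" using Determinant.det_transpose[OF D] by simp
    then obtain v where v: "v \<in> carrier_vec m" "v \<noteq> 0\<^sub>v m" "transpose_mat D *\<^sub>v v = 0\<^sub>v m"
      using Determinant.det_0_iff_vec_prod_zero[of "transpose_mat D" m] D by auto
    define X where "X = (\<lambda>j. of_nat (s j - 1) :: complex) ` {..<m}"
    have "inj_on (\<lambda>j. of_nat (s j - 1) :: complex) {..<m}"
    proof
      fix i j assume ij: "i \<in> {..<m}" "j \<in> {..<m}" "(of_nat (s i - 1) :: complex) = of_nat (s j - 1)"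
      have "s i \<in> S" "s j \<in> S" using s ij by (auto simp: bij_betw_def)
      then have "s i \<ge> 1" "s j \<ge> 1" by (auto simp: S_def)
      then have "s i = s j" using ij(3) by (simp only: of_nat_eq_iff)
      then show "i = j" using s ij by (auto simp: bij_betw_def inj_on_def)
    qed
    then have X: "finite X" "card X = m" by (simp_all add: X_def card_image)
    have "(\<Sum>i<m. vec_index v i * ffall i x) = 0" if "x \<in> X" for x
    proof -
      obtain j where j: "j < m" "x = of_nat (s j - 1)" using \<open>x \<in> X\<close> unfolding X_def by blast
      have "vec_index (transpose_mat D *\<^sub>v v) j = (\<Sum>i<m. vec_index v i * ffall i x)"
        using j v(1) by (auto simp: D_def scalar_prod_def lessThan_atLeast0 mult.commute intro!: sum.cong)
      then show ?thesis using v(3) j by simp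
    qed
    from ffall_combination_zero[OF X this] have "v = 0\<^sub>v m" using v(1) by (intro eq_vecI) auto
    then show False using v(2) by simp
  qed
  then show "lcoef m p A \<noteq> 0"
    unfolding lcoef_def minor_eq_cdet cdet_def S_def[symmetric] s_def[symmetric] Lmat_1
    by (simp add: D_def)
qed

section \<open>Quadrics through the quantum Grassmannian\<close>

lemma finite_subsets_p: "finite (subsets_p n p)"
  unfolding subsets_p_def by (rule finite_subset[of _ "Pow {1..n}"]) auto

lemma Cq_eq_Times: "Cq m p q = subsets_p (m + p) p \<times> {..q}"
  by (auto simp: Cq_def)

lemma sum_Cq: "(\<Sum>c\<in>Cq m p q. f c) = (\<Sum>S\<in>subsets_p (m + p) p. \<Sum>a\<le>q. f (S, a))"
  by (simp add: Cq_eq_Times sum.cartesian_product case_prod_eta)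

lemma sum_delta_pair:
  fixes u :: "'a \<Rightarrow> complex"
  assumes "finite S" "a \<in> S" "b \<in> S"
  shows "(\<Sum>x\<in>S. \<Sum>y\<in>S. of_real (if x = a \<and> y = b then c else 0) * u x * u y) = of_real c * u a * u b"
proof -
  have "(\<Sum>x\<in>S. \<Sum>y\<in>S. of_real (if x = a \<and> y = b then c else 0) * u x * u y) =
      (\<Sum>x\<in>S. if x = a then \<Sum>y\<in>S. if y = b then of_real c * u x * u y else 0 else 0)"
    by (intro sum.cong) (auto intro!: sum.cong)
  then show ?thesis using assms by simp
qed

text \<open>The exchange relation with all terms on one side, encoded as a single real form on pairs
  of sets and independent of the matrix.\<close>

lemma exchange_form:
  assumes A: "A \<in> subsets_p n p" and B: "B \<in> subsets_p n p" and "A \<noteq> B"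
  shows "\<exists>E :: nat set \<Rightarrow> nat set \<Rightarrow> real.
    (\<forall>M. (\<Sum>S\<in>subsets_p n p. \<Sum>T\<in>subsets_p n p. of_real (E S T) * minor p M S * minor p M T) = 0) \<and>
    E A B = 1 \<and>
    (\<forall>S T. E S T \<noteq> 0 \<longrightarrow> (S = A \<and> T = B) \<or>
      (\<exists>g\<in>B - A. \<exists>h\<in>A - B. S = insert g (A - {h}) \<and> T = insert h (B - {g})))"
proof -
  note A' = subsets_pD[OF A] and B' = subsets_pD[OF B]
  have "\<not> B \<subseteq> A" using card_subset_eq[of A B] A' B' assms(3) by auto
  then obtain g where g: "g \<in> B - A" by blast
  obtain \<sigma> :: "nat \<Rightarrow> real" where \<sigma>: "\<forall>M. minor p M A * minor p M B =
    (\<Sum>h\<in>A - B. of_real (\<sigma> h) * (minor p M (insert g (A - {h})) * minor p M (insert h (B - {g}))))"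
    using minor_exchange[OF A'(3,2) B'(3,2) g] by (rule exE)
  define E where "E S T = (if S = A \<and> T = B then 1 else 0) -
    (\<Sum>h\<in>A - B. if S = insert g (A - {h}) \<and> T = insert h (B - {g}) then \<sigma> h else 0)" for S T
  have sub: "insert g (A - {h}) \<in> subsets_p n p" "insert h (B - {g}) \<in> subsets_p n p"
    if h: "h \<in> A - B" for h
  proof -
    have "p > 0" using h A' card_gt_0_iff[of A] by auto
    then show "insert g (A - {h}) \<in> subsets_p n p" "insert h (B - {g}) \<in> subsets_p n p"
      using h g A' B' by (auto simp: subsets_p_def card_insert_if)
  qed
  have "(\<Sum>S\<in>subsets_p n p. \<Sum>T\<in>subsets_p n p. of_real (E S T) * minor p M S * minor p M T) = 0" for M
  proof -
    let ?U = "subsets_p n p"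
    define F where "F h S T = of_real (if S = insert g (A - {h}) \<and> T = insert h (B - {g}) then \<sigma> h else 0)
         * minor p M S * minor p M T" for h S T
    have "(\<Sum>S\<in>?U. \<Sum>T\<in>?U. of_real (E S T) * minor p M S * minor p M T) =
      (\<Sum>S\<in>?U. \<Sum>T\<in>?U. of_real (if S = A \<and> T = B then 1 else 0) * minor p M S * minor p M T) -
      (\<Sum>S\<in>?U. \<Sum>T\<in>?U. \<Sum>h\<in>A - B. F h S T)"
      unfolding E_def F_def sum_subtractf[symmetric]
      by (intro sum.cong refl) (simp only: of_real_diff of_real_sum left_diff_distrib sum_distrib_right)
    also have "(\<Sum>S\<in>?U. \<Sum>T\<in>?U. \<Sum>h\<in>A - B. F h S T) = (\<Sum>S\<in>?U. \<Sum>h\<in>A - B. \<Sum>T\<in>?U. F h S T)"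
      by (rule sum.cong[OF refl], rule sum.swap)
    also have "\<dots> = (\<Sum>h\<in>A - B. \<Sum>S\<in>?U. \<Sum>T\<in>?U. F h S T)"
      by (rule sum.swap)
    also have "\<dots> = (\<Sum>h\<in>A - B. of_real (\<sigma> h) * minor p M (insert g (A - {h})) * minor p M (insert h (B - {g})))"
      unfolding F_def by (intro sum.cong refl sum_delta_pair finite_subsets_p sub)
    finally show ?thesis
      unfolding sum_delta_pair[OF finite_subsets_p A B] using spec[OF \<sigma>, of M] by (simp add: mult.assoc)
  qed
  moreover have "E A B = 1"
  proof -
    \<comment> \<open>Since \<open>g\<close> is not in \<open>A\<close>, no exchange term meets the
      pair \<open>(A, B)\<close>.\<close>
    have "A \<noteq> insert g (A - {h})" for h using g by blast
    then show ?thesis by (simp add: E_def)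
  qed
  moreover have "(S = A \<and> T = B) \<or>
      (\<exists>g\<in>B - A. \<exists>h\<in>A - B. S = insert g (A - {h}) \<and> T = insert h (B - {g}))" if "E S T \<noteq> 0" for S T
  proof (rule ccontr)
    assume n: "\<not> ?thesis"
    then have zero: "(\<Sum>h\<in>A - B. if S = insert g (A - {h}) \<and> T = insert h (B - {g}) then \<sigma> h else 0) = 0"
      using g by (intro sum.neutral) auto
    have "\<not> (S = A \<and> T = B)" using n by blast
    then have "E S T = 0" unfolding E_def zero by (simp only: if_False diff_0_right)
    then show False using that by simp
  qed
  ultimately show ?thesis by (intro exI[of _ E] conjI allI impI)
qed

text \<open>Restricting to real coefficients makes the common zero locus invariant under
  conjugation.\<close>

definition quadrics :: "nat \<Rightarrow> nat \<Rightarrow> nat \<Rightarrow> (nat set \<times> nat \<Rightarrow> nat set \<times> nat \<Rightarrow> real) set" where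
  "quadrics m p q = {B. \<forall>z\<in>plucker_image m p q.
     (\<Sum>c\<in>Cq m p q. \<Sum>d\<in>Cq m p q. of_real (B c d) * z c * z d) = 0}"

text \<open>The minors of a point of the Pluecker image are forms in \<open>s, t\<close>; compare coefficients at \<open>t = 1\<close>.\<close>
lemma coefficient_quadric:
  assumes E: "\<And>M. (\<Sum>S\<in>subsets_p (m + p) p. \<Sum>T\<in>subsets_p (m + p) p.
      of_real (E S T) * minor p M S * minor p M T) = 0"
  shows "(\<lambda>c d. if snd c + snd d = k then E (fst c) (fst d) else 0) \<in> quadrics m p q"
  unfolding quadrics_def
proof (intro CollectI ballI)
  fix z assume "z \<in> plucker_image m p q"
  then obtain M where M: "\<And>A s t. A \<in> subsets_p (m + p) p \<Longrightarrow>
      minor p (\<lambda>i j. M i j s t) A = (\<Sum>a\<le>q. z (A, a) * s ^ a * t ^ (q - a))"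
    unfolding plucker_image_def by blast
  let ?U = "subsets_p (m + p) p" and ?C = "Cq m p q"
  define Q where "Q = (\<Sum>c\<in>?C. \<Sum>d\<in>?C.
    Polynomial.monom (of_real (E (fst c) (fst d)) * z c * z d) (snd c + snd d))"
  have "poly Q s = 0" for s
  proof -
    have "poly Q s = (\<Sum>c\<in>?C. \<Sum>d\<in>?C.
        of_real (E (fst c) (fst d)) * (z c * s ^ snd c) * (z d * s ^ snd d))"
      by (simp add: Q_def poly_sum poly_monom power_add mult_ac)
    also have "\<dots> = (\<Sum>S\<in>?U. \<Sum>a\<le>q. \<Sum>T\<in>?U. \<Sum>b\<le>q.
        of_real (E S T) * (z (S, a) * s ^ a) * (z (T, b) * s ^ b))"
      by (simp add: sum_Cq)
    also have "\<dots> = (\<Sum>S\<in>?U. \<Sum>T\<in>?U. \<Sum>a\<le>q. \<Sum>b\<le>q.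
        of_real (E S T) * (z (S, a) * s ^ a) * (z (T, b) * s ^ b))"
      by (rule sum.cong[OF refl], rule sum.swap)
    also have "\<dots> = (\<Sum>S\<in>?U. \<Sum>T\<in>?U. of_real (E S T) *
        (\<Sum>a\<le>q. z (S, a) * s ^ a) * (\<Sum>b\<le>q. z (T, b) * s ^ b))"
      unfolding mult.assoc sum_product
      by (intro sum.cong refl) (simp only: sum_distrib_left mult.assoc)
    also have "\<dots> = (\<Sum>S\<in>?U. \<Sum>T\<in>?U. of_real (E S T) *
        minor p (\<lambda>i j. M i j s 1) S * minor p (\<lambda>i j. M i j s 1) T)"
      by (intro sum.cong refl) (simp add: M)
    also have "\<dots> = 0" by (rule E)
    finally show ?thesis .
  qed
  then have "Q = 0" by (simp add: poly_all_0_iff_0[symmetric])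
  then have "0 = Polynomial.coeff Q k" by simp
  also have "\<dots> = (\<Sum>c\<in>?C. \<Sum>d\<in>?C.
      of_real (if snd c + snd d = k then E (fst c) (fst d) else 0) * z c * z d)"
    unfolding Q_def Polynomial.coeff_sum by (intro sum.cong refl) simp
  finally show "(\<Sum>c\<in>?C. \<Sum>d\<in>?C.
      of_real (if snd c + snd d = k then E (fst c) (fst d) else 0) * z c * z d) = 0" by simp
qed

text \<open>In the coefficient of \<open>s ^ (i + j)\<close> the exponents redistribute with
  constant sum. If the sets stay the same, one exponent rises unless the term is the original one;
  exchanged sets are covered by \<open>exchange_goes_up\<close>.\<close>

lemma quadric_straightening:
  assumes b: "b \<in> Cq m p q" and g: "g \<in> Cq m p q" and inc: "\<not> leC p b g" "\<not> leC p g b"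
  shows "\<exists>B\<in>quadrics m p q. B b g \<noteq> 0 \<and> (\<forall>c\<in>Cq m p q. \<forall>d\<in>Cq m p q. B c d \<noteq> 0 \<longrightarrow>
        (c = b \<and> d = g) \<or> (leC p b c \<and> c \<noteq> b) \<or> (leC p g d \<and> d \<noteq> g))"
proof -
  obtain S i where b': "b = (S, i)" by fastforce
  obtain T j where g': "g = (T, j)" by fastforce
  have ST: "S \<in> subsets_p (m + p) p" "T \<in> subsets_p (m + p) p"
    using b g by (auto simp: b' g' Cq_def)
  \<comment> \<open>Two indices with the same set are always comparable.\<close>
  have "S \<noteq> T"
    using inc leC_same_set[of S i m p q j] leC_same_set[of S j m p q i] b g
    unfolding b' g' by (metis nat_le_linear)
  from exchange_form[OF ST this] obtain E :: "nat set \<Rightarrow> nat set \<Rightarrow> real" where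
    E: "\<forall>M. (\<Sum>S\<in>subsets_p (m + p) p. \<Sum>T\<in>subsets_p (m + p) p.
       of_real (E S T) * minor p M S * minor p M T) = 0" "E S T = 1"
    "\<forall>S' T'. E S' T' \<noteq> 0 \<longrightarrow> (S' = S \<and> T' = T) \<or>
      (\<exists>g\<in>T - S. \<exists>h\<in>S - T. S' = insert g (S - {h}) \<and> T' = insert h (T - {g}))"
    by blast
  define B where "B c d = (if snd c + snd d = i + j then E (fst c) (fst d) else 0)"
    for c d :: "nat set \<times> nat"
  have "B \<in> quadrics m p q" unfolding B_def[abs_def] by (rule coefficient_quadric) (rule E(1)[rule_format])
  moreover have "B b g \<noteq> 0" by (simp add: B_def b' g' E)
  moreover have "(c = b \<and> d = g) \<or> (leC p b c \<and> c \<noteq> b) \<or> (leC p g d \<and> d \<noteq> g)"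
    if cd: "c \<in> Cq m p q" "d \<in> Cq m p q" "B c d \<noteq> 0" for c d
  proof -
    obtain S' i' where c': "c = (S', i')" by fastforce
    obtain T' j' where d': "d = (T', j')" by fastforce
    have ij: "i' + j' = i + j" and "E S' T' \<noteq> 0" using cd(3) by (auto simp: B_def c' d' split: if_splits)
    from E(3)[rule_format, OF this(2)] show ?thesis
    proof (elim disjE conjE bexE)
      assume eq: "S' = S" "T' = T"
      show ?thesis
      proof (cases i' i rule: linorder_cases)
        case less
        then show ?thesis using ij cd g leC_same_set[of T j m p q j'] by (auto simp: c' d' g' eq)
      next
        case equal
        then show ?thesis using ij by (simp add: c' d' b' g' eq)
      next
        case greater
        then show ?thesis using ij cd b leC_same_set[of S i m p q i'] by (auto simp: c' d' b' eq)
      qed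
    next
      fix x y assume xy: "x \<in> T - S" "y \<in> S - T" "S' = insert x (S - {y})" "T' = insert y (T - {x})"
      then have "c \<noteq> b" "d \<noteq> g" by (auto simp: c' d' b' g')
      then show ?thesis
        using exchange_goes_up[of S i m p q T j x y i' j'] b g cd(1,2) xy ij by (auto simp: b' g' c' d')
    qed
  qed
  ultimately show ?thesis by blast
qed

lemma lcoef_Cq:
  assumes "c \<in> Cq m p q"
  shows "lcoef m p (fst c) \<noteq> 0" "lcoef m p (fst c) = of_real (Re (lcoef m p (fst c)))"
proof -
  have "fst c \<in> subsets_p (m + p) p" using assms by (auto simp: Cq_def)
  note A = subsets_pD[OF this]
  have "card ({1..m + p} - fst c) = m" using A by (simp add: card_Diff_subset)
  from lcoef_real_nonzero[OF this]
  show "lcoef m p (fst c) \<noteq> 0" "lcoef m p (fst c) = of_real (Re (lcoef m p (fst c)))" by auto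
qed

lemma straightening_poset_Cq:
  assumes "0 < m + p"
  shows "straightening_poset (Cq m p q) (leC p) (rank_C m p) (Nbig m p q)
    (\<lambda>c. Re (lcoef m p (fst c))) (quadrics m p q)"
proof
  show "finite (Cq m p q)" by (simp add: Cq_eq_Times finite_subsets_p)
  show "leC p c c" if "c \<in> Cq m p q" for c using that by (simp add: leC_level)
  show "leC p c e" if "c \<in> Cq m p q" "d \<in> Cq m p q" "e \<in> Cq m p q" "leC p c d" "leC p d e" for c d e
    using that by (simp add: leC_level) (meson order_trans)
  show "rank_C m p c < rank_C m p d"
    if "c \<in> Cq m p q" "d \<in> Cq m p q" "leC p c d" "c \<noteq> d" for c d
    using that assms by (rule rank_strict_mono)
  show "rank_C m p c \<le> Nbig m p q" if "c \<in> Cq m p q" for c using that by (rule rank_le_Nbig)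
  show "Re (lcoef m p (fst c)) \<noteq> 0" if "c \<in> Cq m p q" for c
    using lcoef_Cq[OF that] by (metis of_real_0)
qed (rule quadric_straightening)

section \<open>Tangent spaces\<close>

lemma polyfun_sum:
  assumes "finite S" "\<And>s. s \<in> S \<Longrightarrow> f s \<in> polyfun"
  shows "(\<lambda>z. \<Sum>s\<in>S. f s z) \<in> polyfun"
  using assms by (induction S) (auto intro: pf_const pf_add)

lemma polyfun_scale: "f \<in> polyfun \<Longrightarrow> (\<lambda>z. f (\<lambda>c. a * z c)) \<in> polyfun"
proof (induction rule: polyfun.induct)
  case (pf_var c)
  show ?case by (rule pf_mult[OF polyfun.pf_const polyfun.pf_var])
qed (auto intro: polyfun.intros)

text \<open>Composing a polynomial that vanishes on \<open>S\<close> with the scaling gives another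
  one.\<close>

lemma zariski_closure_scale:
  assumes "\<And>y. y \<in> S \<Longrightarrow> (\<lambda>c. a * y c) \<in> S" "z \<in> zariski_closure S"
  shows "(\<lambda>c. a * z c) \<in> zariski_closure S"
  unfolding zariski_closure_def
proof (intro CollectI ballI impI)
  fix f assume f: "f \<in> polyfun" "\<forall>y\<in>S. f y = 0"
  then have "\<forall>y\<in>S. f (\<lambda>c. a * y c) = 0" using assms(1) by simp
  then show "f (\<lambda>c. a * z c) = 0"
    using assms(2) polyfun_scale[OF f(1), of a] by (auto simp: zariski_closure_def)
qed

lemma Kq_vanish:
  "\<lbrakk>z \<in> Kq m p q; f \<in> polyfun; \<And>y. y \<in> plucker_image m p q \<Longrightarrow> f y = 0\<rbrakk> \<Longrightarrow> f z = 0"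
  by (auto simp: Kq_def zariski_closure_def)

lemma minor_scale_row:
  assumes "r \<ge> 1"
  shows "minor r (\<lambda>i j. (if i = 1 then a else 1) * M i j) A = a * minor r M A"
  using assms by (simp add: minor_def prod.distrib sum_distrib_left mult_ac)

lemma is_form_scale: "is_form F \<Longrightarrow> is_form (\<lambda>s t. a * F s t)"
proof -
  assume "is_form F"
  then obtain d c where "\<And>s t. F s t = (\<Sum>k\<le>d. c k * s ^ k * t ^ (d - k))" by (auto simp: is_form_def)
  then show ?thesis unfolding is_form_def
    by (intro exI[of _ d] exI[of _ "\<lambda>k. a * c k"]) (simp add: sum_distrib_left mult.assoc)
qed

lemma plucker_image_outside: "z \<in> plucker_image m p q \<Longrightarrow> c \<notin> Cq m p q \<Longrightarrow> z c = 0"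
  unfolding plucker_image_def by blast

text \<open>The scalar is put into the first row of \<open>M\<close>; being nonzero, it preserves
  the rank condition.\<close>

lemma plucker_image_scale:
  assumes "z \<in> plucker_image m p q" "a \<noteq> 0" "p \<ge> 1"
  shows "(\<lambda>c. a * z c) \<in> plucker_image m p q"
proof -
  obtain M where M: "is_map (m + p) p M" "\<And>A s t. A \<in> subsets_p (m + p) p \<Longrightarrow>
      minor p (\<lambda>i j. M i j s t) A = (\<Sum>b\<le>q. z (A, b) * s ^ b * t ^ (q - b))"
    using assms(1) unfolding plucker_image_def by blast
  define M' where "M' i j s t = (if i = 1 then a else 1) * M i j s t" for i j s t
  have minor: "minor p (\<lambda>i j. M' i j s t) A = a * minor p (\<lambda>i j. M i j s t) A" for s t A
    unfolding M'_def using assms(3) by (rule minor_scale_row)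
  have "is_form (M' i j)" for i j
    using M(1) unfolding M'_def by (intro is_form_scale) (simp add: is_map_def)
  then have "is_map (m + p) p M'"
    using M(1) assms(2) by (auto simp: is_map_def minor)
  moreover have "minor p (\<lambda>i j. M' i j s t) A = (\<Sum>b\<le>q. a * z (A, b) * s ^ b * t ^ (q - b))"
    if "A \<in> subsets_p (m + p) p" for A s t
    by (simp add: minor M(2)[OF that] sum_distrib_left mult.assoc)
  moreover have "a * z c = 0" if "c \<notin> Cq m p q" for c
    using plucker_image_outside[OF assms(1) that] by simp
  ultimately show ?thesis
    unfolding plucker_image_def by (intro CollectI conjI allI impI exI[of _ M'] ballI)
qed

lemma Zq_scale: "z \<in> Zq m p q d \<Longrightarrow> a \<noteq> 0 \<Longrightarrow> p \<ge> 1 \<Longrightarrow> (\<lambda>c. a * z c) \<in> Zq m p q d"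
  using zariski_closure_scale[of "plucker_image m p q" a z, OF plucker_image_scale]
  by (simp add: Zq_def Kq_def)

text \<open>Along the radial direction the point is merely multiplied by \<open>1 + e * u\<close>,
  nonzero for small \<open>e\<close>, so a polynomial vanishing on the cone is constantly zero near
  \<open>e = 0\<close>.\<close>

lemma cone_line_tangent:
  assumes cone: "\<And>a z. z \<in> V \<Longrightarrow> a \<noteq> 0 \<Longrightarrow> (\<lambda>c. a * z c) \<in> V" and x: "x \<in> V"
  shows "(\<lambda>c. u * x c) \<in> tangent_space V x"
  unfolding tangent_space_def
proof (intro CollectI ballI impI)
  fix f :: "('a \<Rightarrow> complex) \<Rightarrow> complex" assume f: "\<forall>y\<in>V. f y = 0"
  have "open {e. 1 + e * u \<noteq> 0}" by (intro open_Collect_neq continuous_intros)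
  then have "\<forall>\<^sub>F e in nhds 0. 1 + e * u \<noteq> 0"
    using eventually_nhds_in_open[of "{e. 1 + e * u \<noteq> 0}" 0] by simp
  then have "\<forall>\<^sub>F e in nhds 0. f (\<lambda>c. x c + e * (u * x c)) = 0"
  proof eventually_elim
    case (elim e)
    have "(\<lambda>c. x c + e * (u * x c)) = (\<lambda>c. (1 + e * u) * x c)" by (simp add: algebra_simps)
    then show ?case using f cone[OF x elim] by simp
  qed
  then have "((\<lambda>e. f (\<lambda>c. x c + e * (u * x c))) has_field_derivative 0) (at 0) \<longleftrightarrow>
      ((\<lambda>_. 0) has_field_derivative 0) (at (0::complex))"
    by (intro DERIV_cong_ev refl)
  then show "((\<lambda>e. f (\<lambda>c. x c + e * (u * x c))) has_field_derivative 0) (at 0)" by simp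
qed

lemma tangent_coordinate:
  assumes "v \<in> tangent_space V x" "\<And>y. y \<in> V \<Longrightarrow> y c = 0"
  shows "v c = 0"
proof -
  have "((\<lambda>e. x c + e * v c) has_field_derivative 0) (at 0)"
    using assms pf_var[of c] by (auto simp: tangent_space_def)
  moreover have "((\<lambda>e. x c + e * v c) has_field_derivative v c) (at 0)"
    by (auto intro!: derivative_eq_intros)
  ultimately show ?thesis using DERIV_unique by blast
qed

context straightening_poset
begin

lemma polyfun_bil: "(\<lambda>z. bil B z z) \<in> polyfun"
  unfolding bil_def by (intro polyfun_sum fin pf_mult pf_const pf_var)

text \<open>Along the line \<open>x + e * v\<close> the quadric is a polynomial in \<open>e\<close>
  whose linear coefficient is the linearised form.\<close>

lemma tangent_bil:
  assumes "v \<in> tangent_space X x" "\<And>y. y \<in> X \<Longrightarrow> bil B y y = 0"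
  shows "bil B v x + bil B x v = 0"
proof -
  have "((\<lambda>e. bil B (\<lambda>c. x c + e * v c) (\<lambda>c. x c + e * v c)) has_field_derivative 0) (at 0)"
    using assms polyfun_bil[of B] by (auto simp: tangent_space_def)
  moreover have "bil B (\<lambda>c. x c + e * v c) (\<lambda>c. x c + e * v c) =
      bil B x x + e * (bil B v x + bil B x v) + e * e * bil B v v" for e
    using bil_lin1[of B 1 x e v] bil_lin2[of B _ 1 x e v] by (simp add: algebra_simps)
  ultimately have "((\<lambda>e. bil B x x + e * (bil B v x + bil B x v) + e * e * bil B v v)
      has_field_derivative 0) (at 0)" by simp
  moreover have "((\<lambda>e. bil B x x + e * (bil B v x + bil B x v) + e * e * bil B v v)
      has_field_derivative (bil B v x + bil B x v)) (at 0)"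
    by (auto intro!: derivative_eq_intros)
  ultimately show ?thesis using DERIV_unique by blast
qed

end

section \<open>Transversality and reality on the quantum Schubert varieties\<close>

theorem theorem4:
  fixes m p q :: nat
  assumes "m > 1" and "p > 1"
  shows "\<exists>t :: nat \<Rightarrow> real. (\<forall>i\<in>{1..Nbig m p q}. t i > 0) \<and>
    (\<forall>d\<in>Cq m p q.
       let V = Zq m p q d;
           W = (\<Inter>i\<in>{1..rank_C m p d}. Hyp m p q 1 (complex_of_real (t i)))
       in transverse_at_points V W \<and>
          (\<forall>x\<in>V \<inter> W. x \<noteq> (\<lambda>c. 0) \<longrightarrow> real_point x))"
proof -
  interpret straightening_poset "Cq m p q" "leC p" "rank_C m p" "Nbig m p q"
    "\<lambda>c. Re (lcoef m p (fst c))" "quadrics m p q"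
    using assms by (intro straightening_poset_Cq) simp
  have Lam: "Lambda m p q 1 (complex_of_real s) z = Lam s z" for s z
    unfolding Lambda_def Lam_def using lcoef_Cq(2) by (intro sum.cong) auto
  have Z_supp: "z c = 0" if "z \<in> Zq m p q d" "\<not> (c \<in> Cq m p q \<and> leC p c d)" for z c d
  proof (cases "c \<in> Cq m p q")
    case False
    have "z \<in> Kq m p q" using that(1) by (simp add: Zq_def)
    then show ?thesis
      by (rule Kq_vanish[OF _ pf_var]) (rule plucker_image_outside[OF _ False])
  qed (use that in \<open>auto simp: Zq_def\<close>)
  have Z_bil: "bil B z z = 0" if "z \<in> Zq m p q d" "B \<in> quadrics m p q" for B z d
    by (rule Kq_vanish[OF _ polyfun_bil]) (use that in \<open>auto simp: Zq_def quadrics_def bil_def\<close>)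
  have Z_V: "Zq m p q d \<subseteq> V d" for d
    using Z_supp Z_bil unfolding V_def supp_le_def by blast
  have tangent_T: "tangent_space (Zq m p q d) x \<subseteq> T d x x" for d x
  proof
    fix v assume v: "v \<in> tangent_space (Zq m p q d) x"
    have "v c = 0" if "\<not> (c \<in> Cq m p q \<and> leC p c d)" for c
      by (rule tangent_coordinate[OF v]) (rule Z_supp[OF _ that])
    moreover have "bil B v x + bil B x v = 0" if "B \<in> quadrics m p q" for B
      by (rule tangent_bil[OF v]) (rule Z_bil[OF _ that])
    ultimately show "v \<in> T d x x"
      unfolding T_def supp_le_def by blast
  qed
  \<comment> \<open>No rank exceeds \<open>Nbig\<close>, so one sequence serves every index
    \<open>d\<close>.\<close>
  obtain t where t: "\<And>i. t i > 0" "\<And>r. r \<le> Nbig m p q \<Longrightarrow> good t r"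
    using real_transverse_sequence by metis
  have W: "(\<Inter>i\<in>{1..r}. Hyp m p q 1 (complex_of_real (t i))) = W t r" for r
    by (auto simp: Hyp_def Lam W_def)
  have main: "tangent_space (Zq m p q d) x \<inter> W t (rank_C m p d) = {\<lambda>c. u * x c |u. True} \<and> real_point x"
    if d: "d \<in> Cq m p q" and x: "x \<in> Zq m p q d" "x \<in> W t (rank_C m p d)" "x \<noteq> (\<lambda>c. 0)" for d x
  proof -
    have "T d x x \<inter> W t (rank_C m p d) \<subseteq> range (\<lambda>u c. u * x c) \<and> real_point x"
      using good_transverse[OF t(2)[OF rk_le[OF d]] d refl] x Z_V by blast
    \<comment> \<open>The variety is a cone, so the line through \<open>x\<close> is tangent; this
      gives the inclusion opposite to the one from \<open>good\<close>.\<close>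
    moreover have "(\<lambda>c. u * x c) \<in> tangent_space (Zq m p q d) x" for u
      using assms(2) by (intro cone_line_tangent x(1) Zq_scale) auto
    ultimately show ?thesis using tangent_T[of d x] W_scale[OF x(2)] by blast
  qed
  show ?thesis
    unfolding Let_def
  proof (intro exI[of _ t] conjI ballI impI)
    fix d assume d: "d \<in> Cq m p q"
    show "transverse_at_points (Zq m p q d) (\<Inter>i\<in>{1..rank_C m p d}. Hyp m p q 1 (complex_of_real (t i)))"
      unfolding W transverse_at_points_def
    proof (intro ballI impI)
      fix x assume "x \<in> Zq m p q d \<inter> W t (rank_C m p d)" "x \<noteq> (\<lambda>c. 0)"
      then show "tangent_space (Zq m p q d) x \<inter> W t (rank_C m p d) = {\<lambda>c. u * x c |u. True}"
        using main[OF d, of x] by simp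
    qed
    fix x assume "x \<in> Zq m p q d \<inter> (\<Inter>i\<in>{1..rank_C m p d}. Hyp m p q 1 (complex_of_real (t i)))"
      "x \<noteq> (\<lambda>c. 0)"
    then show "real_point x" unfolding W using main[OF d, of x] by simp
  qed (rule t(1))
qed

end
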